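(* For every $n\in\mathbb{N}$ let $\sigma=\sigma_n$ be a uniformly distributed random permutation in the symmetric group $\mathcal{S}_n$ and let $$C_n=\frac{1}{n}\sum_{k=1}^n \sigma(k)\, e^{2\pi i k/n}.$$ Let $X_n=\frac{1}{\sqrt{n}}\operatorname{Re}[C_n]$ and $Y_n=\frac{1}{\sqrt{n}}\operatorname{Im}[C_n]$. Then the distribution of $(X_n,Y_n)^T$ converges weakly, as $n\to\infty$, to a two-dimensional Gaussian distribution with mean $(0,0)^T$ and covariance matrix $$\Gamma=\begin{pmatrix}\frac{1}{24}&0\\ 0&\frac{1}{24}\end{pmatrix}.$$ In particular, $Z_n=\frac{1}{\sqrt{n}}C_n$ converges weakly, as $n\to\infty$, to a circularly-symmetric centered complex normal distribution with variance $\frac{1}{12}$.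
   Context: $C_n$ is the centroid of the random polygon with vertices $\sigma(1)\zeta_n,\sigma(2)\zeta_n^2,\dots,\sigma(n)\zeta_n^n$, where $\zeta_n=e^{2\pi i/n}$. *)

theory Defs
  imports "HOL-Probability.Probability"
begin

definition weak_conv :: "(nat \<Rightarrow> 'a::topological_space measure) \<Rightarrow> 'a measure \<Rightarrow> bool" where
  "weak_conv M N \<longleftrightarrow>
     (\<forall>f :: 'a \<Rightarrow> real. bounded (range f) \<and> continuous_on UNIV f \<longrightarrow>
        (\<lambda>n. integral\<^sup>L (M n) f) \<longlonglongrightarrow> integral\<^sup>L N f)"

text \<open>Density of the bivariate Gaussian with mean (m1,m2) and covariance matrix
  ((a,b),(b,c)), assumed positive definite.\<close>
definition gauss2_density :: "real \<Rightarrow> real \<Rightarrow> real \<Rightarrow> real \<Rightarrow> real \<Rightarrow> real \<times> real \<Rightarrow> real" where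
  "gauss2_density m1 m2 a b c = (\<lambda>(x, y).
     let d = a * c - b^2; u = x - m1; v = y - m2 in
     exp (- (c * u^2 - 2 * b * u * v + a * v^2) / (2 * d)) / (2 * pi * sqrt d))"

definition gauss2 :: "real \<Rightarrow> real \<Rightarrow> real \<Rightarrow> real \<Rightarrow> real \<Rightarrow> (real \<times> real) measure" where
  "gauss2 m1 m2 a b c = density lborel (\<lambda>p. ennreal (gauss2_density m1 m2 a b c p))"

text \<open>Circularly-symmetric centered complex normal distribution with variance v = E|Z|^2.\<close>
definition complex_normal :: "real \<Rightarrow> complex measure" where
  "complex_normal v = density lborel (\<lambda>z. ennreal (exp (- ((cmod z) ^ 2) / v) / (pi * v)))"

definition centroid :: "nat \<Rightarrow> (nat \<Rightarrow> nat) \<Rightarrow> complex" where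
  "centroid n \<sigma> = (1 / of_nat n) * (\<Sum>k=1..n. of_nat (\<sigma> k) * cis (2 * pi * real k / real n))"

definition unif_perm :: "nat \<Rightarrow> (nat \<Rightarrow> nat) pmf" where
  "unif_perm n = pmf_of_set {\<sigma>. \<sigma> permutes {1..n}}"

end

theory Submission
  imports Defs "HOL-Real_Asymp.Real_Asymp"
begin

text \<open>
  Fix \<open>(s, t)\<close>. As \<open>\<Sum>k. s cos (2\<pi>k/n) + t sin (2\<pi>k/n) = 0\<close>, the linear form \<open>s X\<^sub>n + t Y\<^sub>n\<close> is a
  permutation sum \<open>W = \<Sum>k. a k * c (\<sigma> k)\<close> with centred \<open>a = O(1)\<close> and \<open>c = O(1/sqrt n)\<close>. Stein's
  exchangeable pair argument (composing \<open>\<sigma>\<close> with a random transposition) yields the approximate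
  differential equation \<open>\<phi>'(t) = - v t \<phi>(t) + O(1/sqrt n)\<close> for the characteristic function of \<open>W\<close>, where
  \<open>v = (\<Sum> a\<^sup>2) (\<Sum> c\<^sup>2) / n\<close>, so \<open>\<phi>(1)\<close> is close to \<open>exp (- v/2)\<close>. A two-dimensional
  continuity theorem turns this into weak convergence. The complex statement is the image of the real
  one under \<open>(x, y) \<mapsto> x + iy\<close>.
\<close>

subsection \<open>Continuity theorem in the plane\<close>

text \<open>The values of \<open>\<sigma>\<close> are dependent, so the characteristic function does
  not factor; exchangeability takes the place of independence. The delicate point is to replace the
  averaged squared increments of \<open>W\<close> by the constant \<open>v\<close>. Their
  fluctuation is governed by \<open>\<Sum>k. (a k)\<^sup>2 * (c (\<sigma> k))\<^sup>2\<close>, which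
  is again a permutation sum: once the squares are centred, the second moment formula already proved
  for \<open>W\<close> applies to it, and no fourth moments have to be computed. With
  \<open>q\<close> the product of the bounds for \<open>a\<close> and \<open>c\<close>, the Taylor
  error is of order n q^3 and the fluctuation of order sqrt n * q^2. Both are O(1/sqrt n) because q
  = O(1/sqrt n). The same second moment bound supplies the tightness that the continuity theorem
  needs. The constant 1/24 is 1/2 * 1/12: the mean square of a cosine over the n-th roots of unity,
  times the limiting variance of a uniform rank divided by n. The limit depends on (s, t) only
  through s^2 + t^2, which is why the covariance is a multiple of the identity.\<close>

inductive_set trig_polys :: "(real \<times> real \<Rightarrow> complex) set" where
  monomial: "(\<lambda>p. z * cis (s * fst p + t * snd p)) \<in> trig_polys"
| add: "f \<in> trig_polys \<Longrightarrow> g \<in> trig_polys \<Longrightarrow> (\<lambda>p. f p + g p) \<in> trig_polys"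

lemma trig_polys_const: "(\<lambda>p. z) \<in> trig_polys"
  using trig_polys.monomial[of z 0 0] by simp

lemma trig_polys_monomial_mult:
  assumes "f \<in> trig_polys"
  shows "(\<lambda>p. z * cis (s * fst p + t * snd p) * f p) \<in> trig_polys"
  using assms
proof induction
  case (monomial z' s' t')
  have "(\<lambda>p. z * cis (s * fst p + t * snd p) * (z' * cis (s' * fst p + t' * snd p))) =
      (\<lambda>p. (z * z') * cis ((s + s') * fst p + (t + t') * snd p))"
  proof
    fix p :: "real \<times> real"
    have "cis (s * fst p + t * snd p) * cis (s' * fst p + t' * snd p) =
        cis ((s + s') * fst p + (t + t') * snd p)"
      by (simp add: cis_mult algebra_simps)
    then show "z * cis (s * fst p + t * snd p) * (z' * cis (s' * fst p + t' * snd p)) =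
        (z * z') * cis ((s + s') * fst p + (t + t') * snd p)"
      by (metis mult.assoc mult.left_commute)
  qed
  then show ?case
    by (simp only: trig_polys.monomial)
qed (simp add: distrib_left trig_polys.add)

text \<open>A product of characters is a character, so the span is an algebra. This is what admits
  polynomials in the torus coordinates, while integrals of its members remain combinations of values
  of the characteristic function.\<close>

lemma trig_polys_mult:
  assumes "f \<in> trig_polys" "g \<in> trig_polys"
  shows "(\<lambda>p. f p * g p) \<in> trig_polys"
  using assms(1)
proof induction
  case (monomial z s t)
  show ?case
    by (rule trig_polys_monomial_mult) fact
qed (simp add: distrib_right trig_polys.add)

text \<open>The factor \<open>r\<close> fixes the period. For \<open>r = 1/R\<close> the square of
  half-width \<open>R\<close> becomes angles in [-1, 1], well short of a full turn, so the map is
  injective there.\<close>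

definition torus_map :: "real \<Rightarrow> real \<times> real \<Rightarrow> complex \<times> complex" where
  "torus_map r p = (cis (r * fst p), cis (r * snd p))"

lemma continuous_on_torus_map: "continuous_on S (torus_map r)"
  unfolding torus_map_def by (intro continuous_intros)

lemma trig_polys_torus_coordinate:
  "(\<lambda>p. complex_of_real (Re (fst (torus_map r p)))) \<in> trig_polys"
  "(\<lambda>p. complex_of_real (Im (fst (torus_map r p)))) \<in> trig_polys"
  "(\<lambda>p. complex_of_real (Re (snd (torus_map r p)))) \<in> trig_polys"
  "(\<lambda>p. complex_of_real (Im (snd (torus_map r p)))) \<in> trig_polys"
proof -
  have re: "complex_of_real (cos x) = 1/2 * cis x + 1/2 * cis (- x)"
    and im: "complex_of_real (sin x) = - \<i>/2 * cis x + \<i>/2 * cis (- x)" for x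
    by (simp_all add: complex_eq_iff)
  have lin: "(\<lambda>p. z * cis (s * fst p + t * snd p) + z' * cis (- (s * fst p + t * snd p))) \<in> trig_polys"
    for z z' s t
    using trig_polys.add[OF trig_polys.monomial[of z s t] trig_polys.monomial[of z' "- s" "- t"]]
    by simp
  show "(\<lambda>p. complex_of_real (Re (fst (torus_map r p)))) \<in> trig_polys"
    "(\<lambda>p. complex_of_real (Im (fst (torus_map r p)))) \<in> trig_polys"
    using lin[of "1/2" r 0 "1/2"] lin[of "- \<i>/2" r 0 "\<i>/2"]
    by (simp_all add: torus_map_def re im)
  show "(\<lambda>p. complex_of_real (Re (snd (torus_map r p)))) \<in> trig_polys"
    "(\<lambda>p. complex_of_real (Im (snd (torus_map r p)))) \<in> trig_polys"
    using lin[of "1/2" 0 r "1/2"] lin[of "- \<i>/2" 0 r "\<i>/2"]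
    by (simp_all add: torus_map_def re im)
qed

lemma trig_polys_compose_polynomial:
  assumes "real_polynomial_function g"
  shows "(\<lambda>p. complex_of_real (g (torus_map r p))) \<in> trig_polys"
  using assms
proof induction
  case (linear f)
  then interpret bounded_linear f .
  \<comment> \<open>A real-linear functional on pairs of complex numbers is determined by its values
    on the four real basis vectors.\<close>
  have f: "f x = f (1, 0) * Re (fst x) + f (\<i>, 0) * Im (fst x) + f (0, 1) * Re (snd x) + f (0, \<i>) * Im (snd x)"
    for x
  proof -
    have "x = Re (fst x) *\<^sub>R (1, 0) + Im (fst x) *\<^sub>R (\<i>, 0) + Re (snd x) *\<^sub>R (0, 1) + Im (snd x) *\<^sub>R (0, \<i>)"
      by (auto simp: prod_eq_iff complex_eq_iff)
    then have "f x = f (Re (fst x) *\<^sub>R (1, 0) + Im (fst x) *\<^sub>R (\<i>, 0) + Re (snd x) *\<^sub>R (0, 1) + Im (snd x) *\<^sub>R (0, \<i>))"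
      by simp
    then show ?thesis
      by (simp only: add scaleR mult.commute real_scaleR_def)
  qed
  show ?case
    by (subst f, simp only: of_real_add of_real_mult)
       (intro trig_polys.add trig_polys_mult trig_polys_const trig_polys_torus_coordinate)
qed (simp_all add: trig_polys_const trig_polys.add trig_polys_mult)

text \<open>A continuous function on a square is transported to the torus, which turns the square
  into a compact set with room to spare, extended by Tietze and approximated by Stone--Weierstrass;
  the periodicity keeps the approximation bounded on the whole plane.\<close>

lemma trig_poly_approx:
  fixes f :: "real \<times> real \<Rightarrow> real"
  assumes f: "continuous_on UNIV f" and B: "\<And>p. \<bar>f p\<bar> \<le> B" and R: "R > 0" and e: "e > 0"
  obtains g where "(\<lambda>p. complex_of_real (g p)) \<in> trig_polys" "continuous_on UNIV g"
    "\<And>p. \<bar>g p\<bar> \<le> B + e" "\<And>p. norm p \<le> R \<Longrightarrow> \<bar>f p - g p\<bar> \<le> e"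
proof -
  define E where "E = torus_map (1 / R)"
  define T where "T = sphere (0::complex) 1 \<times> sphere (0::complex) 1"
  have E_cont: "continuous_on S E" for S
    unfolding E_def by (rule continuous_on_torus_map)
  have E_T: "E p \<in> T" for p
    by (simp add: E_def T_def torus_map_def)
  have inj: "inj_on E (cball 0 R)"
  proof (rule inj_onI)
    fix p q assume pq: "p \<in> cball 0 R" "q \<in> cball 0 R" "E p = E q"
    have *: "x = y" if "cis (1 / R * x) = cis (1 / R * y)" "\<bar>x\<bar> \<le> R" "\<bar>y\<bar> \<le> R" for x y
    proof -
      \<comment> \<open>Angles of modulus at most 1 lie in the principal range, so
        \<open>Arg\<close> recovers them from \<open>cis\<close>.\<close>
      have "- pi < u \<and> u \<le> pi" if "\<bar>u\<bar> \<le> 1" for u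
        using that pi_gt3 by linarith
      moreover have "\<bar>1 / R * x\<bar> \<le> 1" "\<bar>1 / R * y\<bar> \<le> 1"
        using that R by (simp_all add: abs_mult)
      ultimately have "1 / R * x = Arg (cis (1 / R * x))" "1 / R * y = Arg (cis (1 / R * y))"
        by (auto intro!: cis_Arg_unique[symmetric] simp: sgn_eq)
      then show ?thesis
        using that R by simp
    qed
    have "\<bar>fst p\<bar> \<le> R" "\<bar>snd p\<bar> \<le> R" "\<bar>fst q\<bar> \<le> R" "\<bar>snd q\<bar> \<le> R"
      using pq(1,2) norm_fst_le[of "fst p" "snd p"] norm_snd_le[of "snd p" "fst p"]
        norm_fst_le[of "fst q" "snd q"] norm_snd_le[of "snd q" "fst q"]
      by simp_all
    then show "p = q"
      using pq(3) by (auto simp: E_def torus_map_def prod_eq_iff intro!: *)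
  qed
  \<comment> \<open>A continuous injection on a compact set has a continuous inverse on its image,
    so \<open>f\<close> can be carried over to a closed part of the torus.\<close>
  define F where "F = the_inv_into (cball 0 R) E"
  have F_cont: "continuous_on (E ` cball 0 R) F"
    unfolding F_def by (rule continuous_on_inv_into[OF E_cont compact_cball inj])
  have F_E: "F (E p) = p" if "p \<in> cball 0 R" for p
    unfolding F_def by (rule the_inv_into_f_f[OF inj that])
  have "continuous_on (E ` cball 0 R) (\<lambda>x. f (F x))"
    by (rule continuous_on_compose2[OF f F_cont]) simp
  moreover have "closedin (top_of_set T) (E ` cball 0 R)"
  proof -
    have "compact (E ` cball 0 R)"
      by (rule compact_continuous_image[OF E_cont]) simp
    then show ?thesis
      using E_T by (intro closed_subset compact_imp_closed) auto
  qed
  moreover have "0 \<le> B"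
    using B[of 0] by linarith
  ultimately obtain h where h: "continuous_on T h" "\<And>x. x \<in> E ` cball 0 R \<Longrightarrow> h x = f (F x)"
    "\<And>x. x \<in> T \<Longrightarrow> norm (h x) \<le> B"
    using Tietze[of "E ` cball 0 R" "\<lambda>x. f (F x)" T B] B by auto
  have "compact T"
    unfolding T_def by (intro compact_Times compact_sphere)
  then obtain g where g: "real_polynomial_function g" "\<And>x. x \<in> T \<Longrightarrow> \<bar>h x - g x\<bar> < e"
    using Stone_Weierstrass_real_polynomial_function[OF _ h(1) e] by blast
  show thesis
  proof (rule that[of "\<lambda>p. g (E p)"])
    show "(\<lambda>p. complex_of_real (g (E p))) \<in> trig_polys"
      unfolding E_def by (rule trig_polys_compose_polynomial) fact
    show "continuous_on UNIV (\<lambda>p. g (E p))"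
      using g(1) real_polynomial_function_eq[of g] continuous_on_polymonial_function[of g]
      by (intro continuous_on_compose2[OF _ E_cont, of UNIV g]) auto
    show "\<bar>g (E p)\<bar> \<le> B + e" for p
      using h(3)[OF E_T, of p] g(2)[OF E_T, of p] by (simp add: real_norm_def)
    show "\<bar>f p - g (E p)\<bar> \<le> e" if "norm p \<le> R" for p
    proof -
      have "h (E p) = f p"
        using that h(2)[of "E p"] F_E[of p] by simp
      then show ?thesis
        using g(2)[OF E_T, of p] by simp
    qed
  qed
qed

section \<open>From convergence of characteristic functions to weak convergence\<close>

lemma trig_polys_integrable:
  assumes "finite_measure M" "(\<lambda>p. p) \<in> borel_measurable M" "f \<in> trig_polys"
  shows "integrable M f"
  using assms(3)
proof induction
  case (monomial z s t)
  interpret finite_measure M by fact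
  have "continuous_on UNIV (\<lambda>p. z * cis (s * fst p + t * snd p))"
    by (intro continuous_intros)
  then have "(\<lambda>p. z * cis (s * fst p + t * snd p)) \<in> borel_measurable M"
    by (rule measurable_compose[OF assms(2) borel_measurable_continuous_onI])
  then show ?case
    by (rule integrable_const_bound[of _ "norm z", rotated]) (simp add: norm_mult)
qed simp

lemma trig_polys_integral_tendsto:
  assumes M: "\<And>n. prob_space (M n)" "\<And>n. (\<lambda>p. p) \<in> borel_measurable (M n)"
    and N: "prob_space N" "(\<lambda>p. p) \<in> borel_measurable N"
    and char: "\<And>s t. (\<lambda>n. \<integral>p. cis (s * fst p + t * snd p) \<partial>M n)
      \<longlonglongrightarrow> (\<integral>p. cis (s * fst p + t * snd p) \<partial>N)"
    and f: "f \<in> trig_polys"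
  shows "(\<lambda>n. integral\<^sup>L (M n) f) \<longlonglongrightarrow> integral\<^sup>L N f"
  using f
proof induction
  case (monomial z s t)
  show ?case
    using tendsto_mult_left[OF char[of s t], of z] by simp
next
  case (add f g)
  have "integrable (M n) f" "integrable (M n) g" "integrable N f" "integrable N g" for n
    using M N add.hyps by (auto intro!: trig_polys_integrable prob_space.finite_measure)
  then show ?case
    using tendsto_add[OF add.IH] by simp
qed

lemma bounded_continuous_integrable:
  fixes f :: "'a::topological_space \<Rightarrow> real"
  assumes "finite_measure M" "(\<lambda>p. p) \<in> borel_measurable M" "continuous_on UNIV f" "\<And>p. \<bar>f p\<bar> \<le> B"
  shows "integrable M f"
  by (rule finite_measure.integrable_const_bound[OF assms(1), where B = B])
     (use assms(4) measurable_compose[OF assms(2) borel_measurable_continuous_onI[OF assms(3)]] in auto)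

text \<open>The bound \<open>K\<close> makes the measures \<open>M n\<close> tight by Chebyshev, and
  the single measure \<open>N\<close> is tight by itself. On a large ball the test function is close
  to a trigonometric polynomial, whose integrals converge by \<open>char\<close>; off the ball both
  functions are bounded and the mass is small.\<close>

theorem char_tendsto_imp_weak_conv:
  fixes M :: "nat \<Rightarrow> (real \<times> real) measure"
  assumes M: "\<And>n. prob_space (M n)" "\<And>n. (\<lambda>p. p) \<in> borel_measurable (M n)"
    and moment: "\<And>n. integrable (M n) (\<lambda>p. (norm p)\<^sup>2)"
      "eventually (\<lambda>n. (\<integral>p. (norm p)\<^sup>2 \<partial>M n) \<le> K) sequentially"
    and N: "prob_space N" "sets N = sets borel"
    and char: "\<And>s t. (\<lambda>n. \<integral>p. cis (s * fst p + t * snd p) \<partial>M n)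
      \<longlonglongrightarrow> (\<integral>p. cis (s * fst p + t * snd p) \<partial>N)"
  shows "weak_conv M N"
  unfolding weak_conv_def
proof (intro allI impI, elim conjE)
  fix f :: "real \<times> real \<Rightarrow> real"
  assume "bounded (range f)" and f: "continuous_on UNIV f"
  then obtain B where B: "\<And>p. \<bar>f p\<bar> \<le> B"
    by (auto simp: bounded_iff)
  interpret N: prob_space N by fact
  have N_meas [measurable]: "(\<lambda>p. p) \<in> borel_measurable N"
    by (simp add: measurable_cong_sets[OF N(2) refl])
  have far: "{p. r < norm p} \<in> sets N" for r
    unfolding N(2) by measurable
  have B0: "B \<ge> 0"
    using B[of 0] by linarith
  have K: "K \<ge> 0"
  proof -
    obtain n where "(\<integral>p. (norm p)\<^sup>2 \<partial>M n) \<le> K"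
      using eventually_happens[OF moment(2)] by auto
    then show ?thesis
      by (rule order.trans[rotated]) simp
  qed
  show "(\<lambda>n. integral\<^sup>L (M n) f) \<longlonglongrightarrow> integral\<^sup>L N f"
  proof (rule LIMSEQ_I)
    fix \<epsilon> :: real assume \<epsilon>: "\<epsilon> > 0"
    \<comment> \<open>The total error will be 2e + e + 2e, hence the 6. The cap at 1 makes
      \<open>L\<close> below a bound for the difference of \<open>f\<close> and its approximation
      that does not depend on \<open>e\<close>, so the radius can be chosen before the
      approximation.\<close>
    define e where "e = min 1 (\<epsilon> / 6)"
    have e: "0 < e" "e \<le> 1" "e \<le> \<epsilon> / 6"
      using \<epsilon> by (auto simp: e_def)
    define L where "L = 2 * B + 1"
    have L: "L > 0"
      using B0 by (simp add: L_def)
    have "(\<lambda>m. measure N {p. real m < norm p}) \<longlonglongrightarrow> measure N (\<Inter>m. {p. real m < norm p})"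
      by (rule N.finite_Lim_measure_decseq) (auto simp: far decseq_def intro: le_less_trans)
    moreover have "(\<Inter>m. {p::real \<times> real. real m < norm p}) = {}"
      by (metis (no_types, lifting) INT_iff Collect_empty_eq Collect_mem_eq UNIV_I less_asym mem_Collect_eq reals_Archimedean2)
    ultimately have "(\<lambda>m. measure N {p. real m < norm p}) \<longlonglongrightarrow> 0"
      by simp
    moreover have "(\<lambda>m. L * K / (real m)\<^sup>2) \<longlonglongrightarrow> 0"
      by real_asymp
    \<comment> \<open>One radius serves both tails: the first condition controls \<open>N\<close>,
      the second is the Chebyshev bound for all \<open>M n\<close> with second moment at most
      \<open>K\<close>.\<close>
    ultimately have "\<forall>\<^sub>F m in sequentially. measure N {p. real m < norm p} < e / L \<and> L * K / (real m)\<^sup>2 < e \<and> m > 0"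
      by (intro eventually_conj order_tendstoD(2) eventually_gt_at_top) (use e L in auto)
    then obtain m where m: "measure N {p. real m < norm p} < e / L" "L * K / (real m)\<^sup>2 < e" "m > 0"
      by (auto dest: eventually_happens)
    obtain g where g: "(\<lambda>p. complex_of_real (g p)) \<in> trig_polys" "continuous_on UNIV g"
      "\<And>p. \<bar>g p\<bar> \<le> B + e" "\<And>p. norm p \<le> m \<Longrightarrow> \<bar>f p - g p\<bar> \<le> e"
      using trig_poly_approx[OF f B, of m e] m e by auto
    have fg: "\<bar>f p - g p\<bar> \<le> L" for p
      using B[of p] g(3)[of p] e by (simp add: L_def abs_le_iff)
    have int: "integrable \<mu> f" "integrable \<mu> g" "integrable \<mu> (\<lambda>p. \<bar>f p - g p\<bar>)"
      if "prob_space \<mu>" "(\<lambda>p. p) \<in> borel_measurable \<mu>" for \<mu>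
    proof -
      show fi: "integrable \<mu> f" and gi: "integrable \<mu> g"
        using bounded_continuous_integrable[OF _ that(2) f B] bounded_continuous_integrable[OF _ that(2) g(2,3)]
          that(1) by (auto simp: prob_space.finite_measure)
      show "integrable \<mu> (\<lambda>p. \<bar>f p - g p\<bar>)"
        using fi gi by simp
    qed
    have diff: "\<bar>integral\<^sup>L \<mu> f - integral\<^sup>L \<mu> g\<bar> \<le> (\<integral>p. \<bar>f p - g p\<bar> \<partial>\<mu>)"
      if "prob_space \<mu>" "(\<lambda>p. p) \<in> borel_measurable \<mu>" for \<mu>
      using int[OF that] integral_abs_bound[of \<mu> "\<lambda>p. f p - g p"] by simp
    have Nfg: "\<bar>integral\<^sup>L N f - integral\<^sup>L N g\<bar> \<le> 2 * e"
    proof -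
      have far_int: "integrable N (indicator {p. real m < norm p} :: _ \<Rightarrow> real)"
        using far by (intro integrable_real_indicator) (auto simp: N.emeasure_eq_measure)
      have "(\<integral>p. \<bar>f p - g p\<bar> \<partial>N) \<le> (\<integral>p. e + L * indicator {p. real m < norm p} p \<partial>N)"
      proof (intro integral_mono int N(1) N_meas)
        show "integrable N (\<lambda>p. e + L * indicator {p. real m < norm p} p)"
          using far_int by simp
        show "\<bar>f p - g p\<bar> \<le> e + L * indicator {p. real m < norm p} p" for p
          using g(4)[of p] fg[of p] e by (auto simp: indicator_def not_less)
      qed
      also have "\<dots> = e + L * measure N {p. real m < norm p}"
        using far_int N.prob_space sets_eq_imp_space_eq[OF N(2)] by simp
      also have "\<dots> \<le> 2 * e"
        using m(1) L by (simp add: field_simps)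
      finally show ?thesis
        using diff[OF N(1) N_meas] by linarith
    qed
    have Mfg: "\<bar>integral\<^sup>L (M n) f - integral\<^sup>L (M n) g\<bar> \<le> 2 * e" if "(\<integral>p. (norm p)\<^sup>2 \<partial>M n) \<le> K" for n
    proof -
      interpret Mn: prob_space "M n" by fact
      \<comment> \<open>Chebyshev in pointwise form: outside the ball the factor
        \<open>(norm p)\<^sup>2 / (real m)\<^sup>2\<close> is at least 1.\<close>
      have le: "\<bar>f p - g p\<bar> \<le> e + L / (real m)\<^sup>2 * (norm p)\<^sup>2" for p
      proof (cases "norm p \<le> m")
        case True
        then show ?thesis
          using g(4)[of p] L by (simp add: add_increasing2)
      next
        case False
        then have "(real m)\<^sup>2 \<le> (norm p)\<^sup>2"
          by (intro power_mono) auto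
        then have "L \<le> L / (real m)\<^sup>2 * (norm p)\<^sup>2"
          using L m(3) by (simp add: field_simps)
        then show ?thesis
          using fg[of p] e by linarith
      qed
      have "(\<integral>p. \<bar>f p - g p\<bar> \<partial>M n) \<le> (\<integral>p. e + L / (real m)\<^sup>2 * (norm p)\<^sup>2 \<partial>M n)"
        using moment(1) by (intro integral_mono int M le) auto
      also have "\<dots> = e + L / (real m)\<^sup>2 * (\<integral>p. (norm p)\<^sup>2 \<partial>M n)"
        using moment(1) by (simp add: Mn.prob_space)
      also have "\<dots> \<le> e + L / (real m)\<^sup>2 * K"
        using L that by (intro add_left_mono mult_left_mono) auto
      also have "\<dots> \<le> 2 * e"
        using m(2) by simp
      finally show ?thesis
        using diff[OF M] by (meson order.trans)
    qed
    have "(\<lambda>n. \<integral>p. complex_of_real (g p) \<partial>M n) \<longlonglongrightarrow> (\<integral>p. complex_of_real (g p) \<partial>N)"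
      by (rule trig_polys_integral_tendsto[OF M N(1) N_meas char g(1)])
    then have "(\<lambda>n. integral\<^sup>L (M n) g) \<longlonglongrightarrow> integral\<^sup>L N g"
      by (simp add: tendsto_of_real_iff)
    then have "\<forall>\<^sub>F n in sequentially. \<bar>integral\<^sup>L (M n) g - integral\<^sup>L N g\<bar> < e"
      using e by (auto dest: tendstoD simp: dist_real_def)
    with moment(2) have "\<forall>\<^sub>F n in sequentially. norm (integral\<^sup>L (M n) f - integral\<^sup>L N f) < \<epsilon>"
    proof eventually_elim
      case (elim n)
      then show ?case
        using Mfg[of n] Nfg e by (simp add: real_norm_def abs_le_iff abs_less_iff)
    qed
    then show "\<exists>no. \<forall>n\<ge>no. norm (integral\<^sup>L (M n) f - integral\<^sup>L N f) < \<epsilon>"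
      by (simp add: eventually_sequentially)
  qed
qed

subsection \<open>Combinatorial central limit theorem\<close>

definition perm_pmf :: "'a set \<Rightarrow> ('a \<Rightarrow> 'a) pmf" where
  "perm_pmf S = pmf_of_set {\<sigma>. \<sigma> permutes S}"

definition perm_sum :: "'a set \<Rightarrow> ('a \<Rightarrow> real) \<Rightarrow> ('a \<Rightarrow> real) \<Rightarrow> ('a \<Rightarrow> 'a) \<Rightarrow> real" where
  "perm_sum S a c \<sigma> = (\<Sum>k\<in>S. a k * c (\<sigma> k))"

lemma set_perm_pmf: "finite S \<Longrightarrow> set_pmf (perm_pmf S) = {\<sigma>. \<sigma> permutes S}"
  unfolding perm_pmf_def
  by (rule set_pmf_of_set) (auto intro: finite_permutations permutes_id)

lemma integrable_perm_pmf [simp]: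
  fixes f :: "('a \<Rightarrow> 'a) \<Rightarrow> 'b::{banach, second_countable_topology}"
  assumes "finite S"
  shows "integrable (perm_pmf S) f"
  by (rule integrable_measure_pmf_finite) (simp add: set_perm_pmf assms finite_permutations)

lemma integral_perm_pmf_cong:
  fixes f g :: "('a \<Rightarrow> 'a) \<Rightarrow> 'b::{banach, second_countable_topology}"
  assumes "finite S" "\<And>\<sigma>. \<sigma> permutes S \<Longrightarrow> f \<sigma> = g \<sigma>"
  shows "integral\<^sup>L (perm_pmf S) f = integral\<^sup>L (perm_pmf S) g"
  by (intro integral_cong_AE) (auto simp: AE_measure_pmf_iff set_perm_pmf assms)

lemma integral_perm_pmf_mono:
  fixes f g :: "('a \<Rightarrow> 'a) \<Rightarrow> real"
  assumes "finite S" "\<And>\<sigma>. \<sigma> permutes S \<Longrightarrow> f \<sigma> \<le> g \<sigma>"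
  shows "integral\<^sup>L (perm_pmf S) f \<le> integral\<^sup>L (perm_pmf S) g"
  by (intro integral_mono_AE) (auto simp: AE_measure_pmf_iff set_perm_pmf assms)

text \<open>Composition with a fixed transposition is an involution of the symmetric group, so it
  preserves the uniform law. Both the uniform marginals and the exchangeability of the pair come
  from this invariance.\<close>

lemma integral_perm_pmf_transpose:
  fixes g :: "('a \<Rightarrow> 'a) \<Rightarrow> 'b::{banach, second_countable_topology}"
  assumes "finite S" "k \<in> S" "l \<in> S"
  shows "(\<integral>\<sigma>. g (\<sigma> \<circ> Transposition.transpose k l) \<partial>perm_pmf S) = (\<integral>\<sigma>. g \<sigma> \<partial>perm_pmf S)"
proof -
  have t: "Transposition.transpose k l permutes S"
    using assms by (simp add: permutes_swap_id)
  have "bij_betw (\<lambda>\<sigma>. \<sigma> \<circ> Transposition.transpose k l) {\<sigma>. \<sigma> permutes S} {\<sigma>. \<sigma> permutes S}"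
    by (rule bij_betw_byWitness[where f' = "\<lambda>\<sigma>. \<sigma> \<circ> Transposition.transpose k l"])
       (auto simp: comp_assoc intro: permutes_compose[OF t])
  then have "map_pmf (\<lambda>\<sigma>. \<sigma> \<circ> Transposition.transpose k l) (perm_pmf S) = perm_pmf S"
    unfolding perm_pmf_def
    by (rule map_pmf_of_set_bij_betw) (auto intro: finite_permutations assms permutes_id)
  then show ?thesis
    by (metis integral_map_pmf)
qed

text \<open>By symmetry every index has the same expectation, and the sum over all indices is the
  constant \<open>\<Sum>j\<in>S. g j\<close>; no permutations are counted.\<close>

lemma integral_perm_pmf_eval:
  fixes g :: "'a \<Rightarrow> real"
  assumes S: "finite S" and k: "k \<in> S"
  shows "(\<integral>\<sigma>. g (\<sigma> k) \<partial>perm_pmf S) = (\<Sum>j\<in>S. g j) / card S"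
proof -
  have eq: "(\<integral>\<sigma>. g (\<sigma> l) \<partial>perm_pmf S) = (\<integral>\<sigma>. g (\<sigma> k) \<partial>perm_pmf S)" if "l \<in> S" for l
    using integral_perm_pmf_transpose[OF S k that, of "\<lambda>\<sigma>. g (\<sigma> k)"] by simp
  have "(\<Sum>j\<in>S. g j) = (\<integral>\<sigma>. (\<Sum>l\<in>S. g (\<sigma> l)) \<partial>perm_pmf S)"
  proof -
    have "(\<integral>\<sigma>. (\<Sum>l\<in>S. g (\<sigma> l)) \<partial>perm_pmf S) = (\<integral>\<sigma>. (\<Sum>j\<in>S. g j) \<partial>perm_pmf S)"
      by (rule integral_perm_pmf_cong[OF S]) (metis sum.reindex_bij_betw permutes_imp_bij)
    then show ?thesis by simp
  qed
  also have "\<dots> = (\<Sum>l\<in>S. \<integral>\<sigma>. g (\<sigma> k) \<partial>perm_pmf S)"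
    by (subst Bochner_Integration.integral_sum) (simp_all add: S eq)
  finally show ?thesis
    using S k by (auto simp: field_simps)
qed

section \<open>Stein's exchangeable pair for centred permutation sums\<close>

locale centered_perm_sum =
  fixes S :: "'a set" and a c :: "'a \<Rightarrow> real"
  assumes fin [simp]: "finite S" and card2: "2 \<le> card S"
    and sum_a: "(\<Sum>k\<in>S. a k) = 0" and sum_c: "(\<Sum>k\<in>S. c k) = 0"
begin

abbreviation "P \<equiv> perm_pmf S"
abbreviation "W \<equiv> perm_sum S a c"
abbreviation "n \<equiv> real (card S)"
abbreviation "A \<equiv> \<Sum>k\<in>S. (a k)\<^sup>2"
abbreviation "C \<equiv> \<Sum>k\<in>S. (c k)\<^sup>2"
abbreviation "V \<equiv> perm_sum S (\<lambda>k. (a k)\<^sup>2) (\<lambda>k. (c k)\<^sup>2)"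

text \<open>The decrease of \<open>W\<close> when the images of \<open>k\<close> and
  \<open>l\<close> are swapped. It changes sign under that swap. The diagonal \<open>k = l\<close>
  contributes 0, so sums may run over all ordered pairs.\<close>

definition D :: "'a \<Rightarrow> 'a \<Rightarrow> ('a \<Rightarrow> 'a) \<Rightarrow> real" where
  "D k l \<sigma> = (a k - a l) * (c (\<sigma> k) - c (\<sigma> l))"

lemma n_ge: "n \<ge> 2"
  using card2 by simp

lemma S_nonempty [simp]: "S \<noteq> {}"
  using card2 by auto

lemma sum_c_perm: "\<sigma> permutes S \<Longrightarrow> (\<Sum>k\<in>S. g (c (\<sigma> k))) = (\<Sum>k\<in>S. g (c k))"
  by (metis (no_types) sum.reindex_bij_betw[of \<sigma> S S "\<lambda>k. g (c k)"] permutes_imp_bij)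

lemma W_transpose:
  assumes "k \<in> S" "l \<in> S"
  shows "W (\<sigma> \<circ> Transposition.transpose k l) = W \<sigma> - D k l \<sigma>"
proof (cases "k = l")
  case False
  have split: "(\<Sum>i\<in>S. f i) = f k + f l + (\<Sum>i\<in>S - {k, l}. f i)" for f :: "'a \<Rightarrow> real"
    using assms False by (subst sum.subset_diff[of "{k, l}"]) auto
  have "(\<Sum>i\<in>S - {k, l}. a i * c ((\<sigma> \<circ> Transposition.transpose k l) i)) = (\<Sum>i\<in>S - {k, l}. a i * c (\<sigma> i))"
    by (rule sum.cong) auto
  then show ?thesis
    unfolding perm_sum_def D_def split by (simp add: algebra_simps)
qed (simp add: D_def)

text \<open>This is the linear regression condition of Stein's method: over a uniform ordered pair
  the mean decrease of \<open>W\<close> is exactly 2/n times \<open>W\<close>. Centring of both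
  families removes the two cross terms, so there is no remainder.\<close>

lemma sum_D:
  assumes "\<sigma> permutes S"
  shows "(\<Sum>k\<in>S. \<Sum>l\<in>S. D k l \<sigma>) = 2 * n * W \<sigma>"
proof -
  have c0: "(\<Sum>k\<in>S. c (\<sigma> k)) = 0"
    using sum_c_perm[OF assms, of "\<lambda>x. x"] sum_c by simp
  have "(\<Sum>k\<in>S. \<Sum>l\<in>S. D k l \<sigma>) =
      (\<Sum>k\<in>S. n * (a k * c (\<sigma> k)) - a k * (\<Sum>l\<in>S. c (\<sigma> l)) - c (\<sigma> k) * (\<Sum>l\<in>S. a l) + W \<sigma>)"
    unfolding D_def perm_sum_def
    by (intro sum.cong refl)
       (simp add: algebra_simps sum.distrib sum_subtractf sum_distrib_left sum_distrib_right)
  also have "\<dots> = 2 * n * W \<sigma>"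
    by (simp add: c0 sum_a sum.distrib perm_sum_def sum_distrib_left algebra_simps)
  finally show ?thesis .
qed

text \<open>Expand the square and sum over both indices: every term containing a plain sum of
  \<open>a\<close> or of \<open>c \<circ> \<sigma>\<close> vanishes by centring. The result is
  exact, so the fluctuation is confined to \<open>V\<close> and to the lower-order term in
  \<open>(W \<sigma>)\<^sup>2\<close>.\<close>

lemma sum_D_squared:
  assumes "\<sigma> permutes S"
  shows "(\<Sum>k\<in>S. \<Sum>l\<in>S. (D k l \<sigma>)\<^sup>2) = 2 * n * V \<sigma> + 2 * A * C + 4 * (W \<sigma>)\<^sup>2"
proof -
  define d where "d = (\<lambda>k. c (\<sigma> k))"
  have d0: "(\<Sum>k\<in>S. d k) = 0"
    using sum_c_perm[OF assms, of "\<lambda>x. x"] sum_c by (simp add: d_def)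
  have d2: "(\<Sum>k\<in>S. (d k)\<^sup>2) = C"
    using sum_c_perm[OF assms, of "\<lambda>x. x\<^sup>2"] by (simp add: d_def)
  define U where "U = (\<Sum>l\<in>S. (a l)\<^sup>2 * (d l)\<^sup>2)"
  define w where "w = (\<Sum>l\<in>S. a l * d l)"
  define X where "X = (\<Sum>l\<in>S. a l * (d l)\<^sup>2)"
  define Y where "Y = (\<Sum>l\<in>S. (a l)\<^sup>2 * d l)"
  define A' where "A' = A"
  define C' where "C' = C"
  have "(\<Sum>l\<in>S. (D k l \<sigma>)\<^sup>2) = n * ((a k)\<^sup>2 * (d k)\<^sup>2) + (a k)\<^sup>2 * C' - 2 * a k * X + 4 * (a k * d k) * w
      + (d k)\<^sup>2 * A' + U - 2 * d k * Y" (is "?l = ?r") for k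
  proof -
    have "?l = (\<Sum>l\<in>S. (a k)\<^sup>2 * (d k)\<^sup>2 + (a k)\<^sup>2 * (d l)\<^sup>2 - 2 * ((a k)\<^sup>2 * d k) * d l
         - 2 * (a k * (d k)\<^sup>2) * a l - 2 * a k * (a l * (d l)\<^sup>2) + 4 * (a k * d k) * (a l * d l)
         + (d k)\<^sup>2 * (a l)\<^sup>2 + (a l)\<^sup>2 * (d l)\<^sup>2 - 2 * d k * ((a l)\<^sup>2 * d l))"
      unfolding D_def d_def by (intro sum.cong refl) (simp add: power2_eq_square algebra_simps)
    also have "\<dots> = n * ((a k)\<^sup>2 * (d k)\<^sup>2) + (a k)\<^sup>2 * (\<Sum>l\<in>S. (d l)\<^sup>2)
         - 2 * ((a k)\<^sup>2 * d k) * (\<Sum>l\<in>S. d l) - 2 * (a k * (d k)\<^sup>2) * (\<Sum>l\<in>S. a l)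
         - 2 * a k * X + 4 * (a k * d k) * w + (d k)\<^sup>2 * A' + U - 2 * d k * Y"
      unfolding U_def w_def X_def Y_def A'_def sum_distrib_left
      by (simp add: sum.distrib sum_subtractf)
    finally show ?thesis
      by (simp add: d0 d2 sum_a C'_def)
  qed
  then have "(\<Sum>k\<in>S. \<Sum>l\<in>S. (D k l \<sigma>)\<^sup>2) = n * U + A' * C' - 2 * (\<Sum>k\<in>S. a k) * X
      + 4 * w * w + (\<Sum>k\<in>S. (d k)\<^sup>2) * A' + n * U - 2 * (\<Sum>k\<in>S. d k) * Y"
    by (simp add: sum.distrib sum_subtractf U_def[symmetric] w_def[symmetric] A'_def[symmetric]
        flip: sum_distrib_left sum_distrib_right)
  also have "\<dots> = 2 * n * U + 2 * A * C + 4 * w\<^sup>2"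
    unfolding A'_def C'_def d0 d2 sum_a by (simp add: power2_eq_square)
  finally show ?thesis
    by (simp add: d_def perm_sum_def U_def w_def)
qed

text \<open>Stein's method: \<open>\<sigma>\<close> and \<open>\<sigma> \<circ> Transposition.transpose k l\<close> form an exchangeable pair.\<close>

lemma exchange:
  fixes h :: "real \<Rightarrow> 'b::{banach, second_countable_topology}"
  shows "(\<integral>\<sigma>. W \<sigma> *\<^sub>R h (W \<sigma>) \<partial>P) =
    (1 / (4 * n)) *\<^sub>R (\<Sum>k\<in>S. \<Sum>l\<in>S. \<integral>\<sigma>. D k l \<sigma> *\<^sub>R (h (W \<sigma>) - h (W \<sigma> - D k l \<sigma>)) \<partial>P)"
proof -
  \<comment> \<open>The transposition turns \<open>D\<close> into \<open>- D\<close> and exchanges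
    \<open>W\<close> with \<open>W - D\<close>, so the two halves of the difference contribute
    equally. This factor 2 and the \<open>2 * n\<close> of \<open>sum_D\<close> give the
    \<open>4 * n\<close>.\<close>
  have swap: "(\<integral>\<sigma>. D k l \<sigma> *\<^sub>R (h (W \<sigma>) - h (W \<sigma> - D k l \<sigma>)) \<partial>P) =
      2 *\<^sub>R (\<integral>\<sigma>. D k l \<sigma> *\<^sub>R h (W \<sigma>) \<partial>P)" if "k \<in> S" "l \<in> S" for k l
  proof -
    have "(\<integral>\<sigma>. D k l \<sigma> *\<^sub>R h (W \<sigma>) \<partial>P) = (\<integral>\<sigma>. - (D k l \<sigma> *\<^sub>R h (W \<sigma> - D k l \<sigma>)) \<partial>P)"
      by (subst integral_perm_pmf_transpose[OF fin that, symmetric])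
         (simp add: W_transpose[OF that, simplified] D_def algebra_simps)
    then show ?thesis
      by (simp add: scaleR_diff_right scaleR_2)
  qed
  have "(\<Sum>k\<in>S. \<Sum>l\<in>S. \<integral>\<sigma>. D k l \<sigma> *\<^sub>R h (W \<sigma>) \<partial>P) =
      (\<integral>\<sigma>. (\<Sum>k\<in>S. \<Sum>l\<in>S. D k l \<sigma>) *\<^sub>R h (W \<sigma>) \<partial>P)"
    by (simp add: scaleR_sum_left Bochner_Integration.integral_sum)
  also have "\<dots> = (\<integral>\<sigma>. (2 * n) *\<^sub>R (W \<sigma> *\<^sub>R h (W \<sigma>)) \<partial>P)"
    by (rule integral_perm_pmf_cong) (simp_all add: sum_D)
  also have "\<dots> = (2 * n) *\<^sub>R (\<integral>\<sigma>. W \<sigma> *\<^sub>R h (W \<sigma>) \<partial>P)"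
    by (rule integral_scaleR_right)
  finally show ?thesis
    by (simp add: swap flip: scaleR_sum_right)
qed

lemma mean_V: "(\<integral>\<sigma>. V \<sigma> \<partial>P) = A * C / n"
proof -
  have "(\<integral>\<sigma>. V \<sigma> \<partial>P) = (\<Sum>k\<in>S. (a k)\<^sup>2 * (\<integral>\<sigma>. (c (\<sigma> k))\<^sup>2 \<partial>P))"
    unfolding perm_sum_def by (simp add: Bochner_Integration.integral_sum)
  also have "\<dots> = (\<Sum>k\<in>S. (a k)\<^sup>2 * (C / n))"
    by (intro sum.cong refl arg_cong2[where f = "(*)"] integral_perm_pmf_eval fin)
  finally show ?thesis
    by (simp flip: sum_distrib_right sum_divide_distrib)
qed

text \<open>For the identity function, \<open>exchange\<close> expresses the second moment through
  the squared increments, and these contain the second moment again. Solving this linear equation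
  produces the denominator \<open>n - 1\<close>.\<close>

lemma second_moment: "(\<integral>\<sigma>. (W \<sigma>)\<^sup>2 \<partial>P) = A * C / (n - 1)"
proof -
  have "(\<integral>\<sigma>. (W \<sigma>)\<^sup>2 \<partial>P) = (1 / (4 * n)) * (\<integral>\<sigma>. (\<Sum>k\<in>S. \<Sum>l\<in>S. (D k l \<sigma>)\<^sup>2) \<partial>P)"
    using exchange[of "\<lambda>x. x"]
    by (simp add: power2_eq_square Bochner_Integration.integral_sum)
  also have "(\<integral>\<sigma>. (\<Sum>k\<in>S. \<Sum>l\<in>S. (D k l \<sigma>)\<^sup>2) \<partial>P) =
      (\<integral>\<sigma>. 2 * n * V \<sigma> + 2 * A * C + 4 * (W \<sigma>)\<^sup>2 \<partial>P)"
    by (rule integral_perm_pmf_cong) (simp_all add: sum_D_squared)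
  also have "\<dots> = 2 * n * (\<integral>\<sigma>. V \<sigma> \<partial>P) + 2 * A * C + 4 * (\<integral>\<sigma>. (W \<sigma>)\<^sup>2 \<partial>P)"
    by simp
  finally have *: "(\<integral>\<sigma>. (W \<sigma>)\<^sup>2 \<partial>P) = 1 / (4 * n) *
      (2 * n * (A * C / n) + 2 * A * C + 4 * (\<integral>\<sigma>. (W \<sigma>)\<^sup>2 \<partial>P))"
    unfolding mean_V .
  have "m = x * y / (r - 1)" if eq: "1 / (4 * r) * (2 * r * (x * y / r) + 2 * x * y + 4 * m) = m"
    and r: "r \<ge> 2" for m x y r :: real
  proof -
    have "1 / (4 * r) * (2 * r * (x * y / r) + 2 * x * y + 4 * m) = (x * y + m) / r"
      using r by (simp add: divide_simps)
    then have "x * y + m = m * r"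
      using eq r by (metis nonzero_divide_eq_eq not_numeral_le_zero)
    then have "m * (r - 1) = x * y"
      by (simp add: algebra_simps)
    then show ?thesis
      using r by (simp add: eq_divide_eq)
  qed
  from this[OF *[symmetric] n_ge] show ?thesis .
qed

end

section \<open>Bounds on moments and fluctuations\<close>

lemma (in prob_space) expectation_abs_le_sqrt:
  fixes X :: "'a \<Rightarrow> real"
  assumes "integrable M X" "integrable M (\<lambda>x. (X x)\<^sup>2)"
  shows "expectation (\<lambda>x. \<bar>X x\<bar>) \<le> sqrt (expectation (\<lambda>x. (X x)\<^sup>2))"
proof -
  have "(expectation (\<lambda>x. \<bar>X x\<bar>))\<^sup>2 \<le> expectation (\<lambda>x. (X x)\<^sup>2)"
    using variance_positive[of "\<lambda>x. \<bar>X x\<bar>"] variance_eq[of "\<lambda>x. \<bar>X x\<bar>"] assms by simp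
  then show ?thesis
    by (rule real_le_rsqrt)
qed

lemma cmod_cis_approx: "cmod (1 - cis (- x) - \<i> * x) \<le> x\<^sup>2 / 2"
  using iexp_approx1[of "- x" 1]
  by (simp add: cis_conv_exp norm_minus_commute algebra_simps power2_eq_square)

context centered_perm_sum
begin

lemma norm_integral_le:
  fixes f :: "('a \<Rightarrow> 'a) \<Rightarrow> 'b::{banach, second_countable_topology}"
  assumes "\<And>\<sigma>. \<sigma> permutes S \<Longrightarrow> norm (f \<sigma>) \<le> B"
  shows "norm (\<integral>\<sigma>. f \<sigma> \<partial>P) \<le> B"
proof -
  have "norm (\<integral>\<sigma>. f \<sigma> \<partial>P) \<le> (\<integral>\<sigma>. norm (f \<sigma>) \<partial>P)"
    by (rule integral_norm_bound)
  also have "\<dots> \<le> (\<integral>\<sigma>. B \<partial>P)"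
    by (rule integral_perm_pmf_mono) (simp_all add: assms)
  finally show ?thesis by simp
qed

text \<open>The law has finite support, so the expectation is a finite sum and is differentiated
  term by term.\<close>

lemma char_derivative:
  "((\<lambda>t. \<integral>\<sigma>. cis (t * W \<sigma>) \<partial>P) has_vector_derivative
     \<i> * (\<integral>\<sigma>. W \<sigma> *\<^sub>R cis (t * W \<sigma>) \<partial>P)) (at t)"
proof -
  have eq: "(\<integral>\<sigma>. f \<sigma> \<partial>P) = (\<Sum>\<sigma> | \<sigma> permutes S. pmf P \<sigma> *\<^sub>R f \<sigma>)"
    for f :: "('a \<Rightarrow> 'a) \<Rightarrow> complex"
    by (rule integral_measure_pmf) (simp_all add: set_perm_pmf finite_permutations)
  show ?thesis
    unfolding eq sum_distrib_left has_vector_derivative_def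
    by (auto intro!: derivative_eq_intros ext simp: scaleR_sum_right scaleR_conv_of_real sum_distrib_left mult_ac)
qed

context
  fixes \<alpha> \<gamma> :: real
  assumes a_le: "\<And>k. k \<in> S \<Longrightarrow> \<bar>a k\<bar> \<le> \<alpha>" and c_le: "\<And>k. k \<in> S \<Longrightarrow> \<bar>c k\<bar> \<le> \<gamma>"
begin

lemma bounds_nonneg: "0 \<le> \<alpha>" "0 \<le> \<gamma>"
proof -
  obtain k where "k \<in> S"
    using card2 by fastforce
  with a_le[OF this] c_le[OF this] show "0 \<le> \<alpha>" "0 \<le> \<gamma>"
    by linarith+
qed

lemma D_le:
  assumes "\<sigma> permutes S" "k \<in> S" "l \<in> S"
  shows "\<bar>D k l \<sigma>\<bar> \<le> 4 * (\<alpha> * \<gamma>)"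
proof -
  have "\<bar>a k - a l\<bar> \<le> 2 * \<alpha>"
    using a_le[OF assms(2)] a_le[OF assms(3)] by linarith
  moreover have "\<sigma> k \<in> S" "\<sigma> l \<in> S"
    using assms by (simp_all add: permutes_in_image)
  then have "\<bar>c (\<sigma> k) - c (\<sigma> l)\<bar> \<le> 2 * \<gamma>"
    using c_le[of "\<sigma> k"] c_le[of "\<sigma> l"] by linarith
  ultimately have "\<bar>D k l \<sigma>\<bar> \<le> (2 * \<alpha>) * (2 * \<gamma>)"
    unfolding D_def abs_mult by (intro mult_mono) (use bounds_nonneg in auto)
  then show ?thesis by simp
qed

lemma squares_le: "A \<le> n * \<alpha>\<^sup>2" "C \<le> n * \<gamma>\<^sup>2"
  using a_le c_le by (auto intro!: sum_bounded_above simp: abs_le_square_iff[symmetric] bounds_nonneg)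

lemma second_moment_le: "(\<integral>\<sigma>. (W \<sigma>)\<^sup>2 \<partial>P) \<le> 2 * n * (\<alpha> * \<gamma>)\<^sup>2"
proof -
  have "A * C \<le> (n * \<alpha>\<^sup>2) * (n * \<gamma>\<^sup>2)"
    by (intro mult_mono squares_le) (auto intro: sum_nonneg)
  then have "A * C / (n - 1) \<le> (n * \<alpha>\<^sup>2) * (n * \<gamma>\<^sup>2) / (n - 1)"
    using n_ge by (intro divide_right_mono) auto
  also have "\<dots> = (n / (n - 1)) * (n * (\<alpha> * \<gamma>)\<^sup>2)"
    by (simp add: power2_eq_square)
  \<comment> \<open>The factor n/(n - 1) is at most 2 because n is at least 2.\<close>
  also have "\<dots> \<le> 2 * (n * (\<alpha> * \<gamma>)\<^sup>2)"
    by (intro mult_right_mono) (use n_ge in \<open>auto simp: field_simps\<close>)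
  finally show ?thesis
    by (simp add: second_moment)
qed

end

text \<open>After subtracting their means, the squares of \<open>a\<close> and \<open>c\<close>
  satisfy the same locale assumptions, so the second moment bound holds for them with
  \<open>\<alpha>\<^sup>2\<close> and \<open>\<gamma>\<^sup>2\<close> as bounds. Cauchy-Schwarz then
  passes to the first absolute moment.\<close>

lemma V_deviation:
  assumes a_le: "\<And>k. k \<in> S \<Longrightarrow> \<bar>a k\<bar> \<le> \<alpha>" and c_le: "\<And>k. k \<in> S \<Longrightarrow> \<bar>c k\<bar> \<le> \<gamma>"
  shows "(\<integral>\<sigma>. \<bar>V \<sigma> - A * C / n\<bar> \<partial>P) \<le> sqrt (2 * n) * (\<alpha> * \<gamma>)\<^sup>2"
proof -
  let ?a = "\<lambda>k. (a k)\<^sup>2 - A / n" and ?c = "\<lambda>k. (c k)\<^sup>2 - C / n"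
  interpret sq: centered_perm_sum S ?a ?c
    using n_ge by unfold_locales (simp_all add: card2 sum_subtractf)
  have V: "perm_sum S ?a ?c \<sigma> = V \<sigma> - A * C / n" if "\<sigma> permutes S" for \<sigma>
  proof -
    have "(\<Sum>k\<in>S. (c (\<sigma> k))\<^sup>2) = C"
      using sum_c_perm[OF that, of "\<lambda>x. x\<^sup>2"] .
    then show ?thesis
      using n_ge unfolding perm_sum_def
      by (simp add: algebra_simps sum.distrib sum_subtractf
          flip: sum_distrib_left sum_distrib_right sum_divide_distrib)
  qed
  \<comment> \<open>Both terms lie between 0 and \<open>b\<^sup>2\<close>, so their difference costs
    no factor 2.\<close>
  have dev: "\<bar>x\<^sup>2 - B / n\<bar> \<le> b\<^sup>2" if "\<bar>x\<bar> \<le> b" "0 \<le> B" "B \<le> n * b\<^sup>2" for x b B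
  proof -
    have "x\<^sup>2 \<le> b\<^sup>2"
      using that(1) by (simp add: abs_le_square_iff[symmetric])
    moreover have "0 \<le> B / n" "B / n \<le> b\<^sup>2"
      using that n_ge by (auto simp: field_simps)
    ultimately show ?thesis
      by (smt (verit) zero_le_power2)
  qed
  have "(\<integral>\<sigma>. \<bar>V \<sigma> - A * C / n\<bar> \<partial>P) = (\<integral>\<sigma>. \<bar>perm_sum S ?a ?c \<sigma>\<bar> \<partial>P)"
    by (rule integral_perm_pmf_cong) (simp_all add: V)
  also have "\<dots> \<le> sqrt (\<integral>\<sigma>. (perm_sum S ?a ?c \<sigma>)\<^sup>2 \<partial>P)"
    by (rule measure_pmf.expectation_abs_le_sqrt) simp_all
  also have "\<dots> \<le> sqrt (2 * n * (\<alpha>\<^sup>2 * \<gamma>\<^sup>2)\<^sup>2)"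
    by (intro real_sqrt_le_mono sq.second_moment_le dev a_le c_le squares_le[OF a_le c_le] sum_nonneg)
       auto
  also have "\<dots> = sqrt (2 * n) * (\<alpha> * \<gamma>)\<^sup>2"
    unfolding real_sqrt_mult real_sqrt_abs by (simp add: power_mult_distrib)
  finally show ?thesis .
qed

end

section \<open>The approximate differential equation and its integration\<close>

context centered_perm_sum
begin

text \<open>There are two replacements. In \<open>exchange\<close> the increment of
  \<open>cis\<close> is replaced by its linear part, and then the random factor \<open>Q\<close> by
  the constant \<open>v\<close>. The first gives the term in \<open>q ^ 3\<close>, the second the
  terms in \<open>q\<^sup>2\<close>.\<close>

lemma char_derivative_approx:
  assumes a_le: "\<And>k. k \<in> S \<Longrightarrow> \<bar>a k\<bar> \<le> \<alpha>" and c_le: "\<And>k. k \<in> S \<Longrightarrow> \<bar>c k\<bar> \<le> \<gamma>"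
  defines "q \<equiv> \<alpha> * \<gamma>"
  shows "cmod (\<i> * (\<integral>\<sigma>. W \<sigma> *\<^sub>R cis (t * W \<sigma>) \<partial>P) + of_real t * of_real (A * C / n) * (\<integral>\<sigma>. cis (t * W \<sigma>) \<partial>P))
    \<le> t\<^sup>2 * (8 * n * q ^ 3) + \<bar>t\<bar> * (sqrt (2 * n) * q\<^sup>2 / 2 + 2 * q\<^sup>2)"
proof -
  define v where "v = A * C / n"
  define Q where "Q \<sigma> = (1 / (4 * n)) * (\<Sum>k\<in>S. \<Sum>l\<in>S. (D k l \<sigma>)\<^sup>2)" for \<sigma>
  define I where "I k l = (\<integral>\<sigma>. D k l \<sigma> *\<^sub>R (cis (t * W \<sigma>) - cis (t * (W \<sigma> - D k l \<sigma>))) \<partial>P)" for k l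
  define J where "J k l = (\<integral>\<sigma>. D k l \<sigma> *\<^sub>R (\<i> * of_real (t * D k l \<sigma>) * cis (t * W \<sigma>)) \<partial>P)" for k l
  \<comment> \<open>Half of \<open>v\<close> is present exactly, and \<open>V\<close> fluctuates
    around \<open>v\<close>; hence \<open>Q\<close> is close to \<open>v\<close> as soon as
    \<open>V\<close> is and \<open>(W \<sigma>)\<^sup>2 / n\<close> is small.\<close>
  have Q_eq: "Q \<sigma> = V \<sigma> / 2 + v / 2 + (W \<sigma>)\<^sup>2 / n" if "\<sigma> permutes S" for \<sigma>
    unfolding Q_def v_def sum_D_squared[OF that] using n_ge by (simp add: field_simps)
  have "(\<integral>\<sigma>. \<bar>Q \<sigma> - v\<bar> \<partial>P) \<le> (\<integral>\<sigma>. \<bar>V \<sigma> - v\<bar> / 2 + (W \<sigma>)\<^sup>2 / n \<partial>P)"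
  proof (rule integral_perm_pmf_mono[OF fin])
    fix \<sigma> assume "\<sigma> permutes S"
    then have "Q \<sigma> - v = (V \<sigma> - v) / 2 + (W \<sigma>)\<^sup>2 / n"
      by (simp add: Q_eq field_simps)
    then show "\<bar>Q \<sigma> - v\<bar> \<le> \<bar>V \<sigma> - v\<bar> / 2 + (W \<sigma>)\<^sup>2 / n"
      by (simp add: order.trans[OF abs_triangle_ineq])
  qed
  also have "\<dots> = (\<integral>\<sigma>. \<bar>V \<sigma> - v\<bar> \<partial>P) / 2 + (\<integral>\<sigma>. (W \<sigma>)\<^sup>2 \<partial>P) / n"
    by simp
  also have "\<dots> \<le> (sqrt (2 * n) * q\<^sup>2) / 2 + (2 * n * q\<^sup>2) / n"
    unfolding v_def q_def
    by (intro add_mono divide_right_mono V_deviation second_moment_le a_le c_le) auto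
  finally have Q_dev: "(\<integral>\<sigma>. \<bar>Q \<sigma> - v\<bar> \<partial>P) \<le> sqrt (2 * n) * q\<^sup>2 / 2 + 2 * q\<^sup>2"
    using n_ge by (auto split: if_splits)
  \<comment> \<open>The second-order Taylor error is (t d)^2/2, multiplied by another |d|. With |d|
    at most 4q this gives 64/2 = 32; summing over n^2 pairs and dividing by 4n leaves 8n.\<close>
  have IJ: "cmod (I k l - J k l) \<le> 32 * t\<^sup>2 * q ^ 3" if kl: "k \<in> S" "l \<in> S" for k l
  proof -
    have "I k l - J k l = (\<integral>\<sigma>. D k l \<sigma> *\<^sub>R (cis (t * W \<sigma>) - cis (t * (W \<sigma> - D k l \<sigma>)))
        - D k l \<sigma> *\<^sub>R (\<i> * of_real (t * D k l \<sigma>) * cis (t * W \<sigma>)) \<partial>P)"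
      unfolding I_def J_def by (rule Bochner_Integration.integral_diff[symmetric]) simp_all
    also have "cmod \<dots> \<le> 32 * t\<^sup>2 * q ^ 3"
    proof (rule norm_integral_le)
      fix \<sigma> assume \<sigma>: "\<sigma> permutes S"
      define d where "d = D k l \<sigma>"
      have d: "\<bar>d\<bar> \<le> 4 * q"
        unfolding d_def q_def using D_le[OF a_le c_le \<sigma> kl] by simp
      have "d *\<^sub>R (cis (t * W \<sigma>) - cis (t * (W \<sigma> - d))) - d *\<^sub>R (\<i> * of_real (t * d) * cis (t * W \<sigma>))
          = d *\<^sub>R (cis (t * W \<sigma>) * (1 - cis (- (t * d)) - \<i> * of_real (t * d)))"
      proof -
        have "cis (t * (W \<sigma> - d)) = cis (t * W \<sigma>) * cis (- (t * d))"
          by (simp add: cis_mult right_diff_distrib)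
        then show ?thesis
          by (simp add: scaleR_conv_of_real algebra_simps)
      qed
      then have "cmod (d *\<^sub>R (cis (t * W \<sigma>) - cis (t * (W \<sigma> - d)))
          - d *\<^sub>R (\<i> * of_real (t * d) * cis (t * W \<sigma>)))
          = \<bar>d\<bar> * cmod (1 - cis (- (t * d)) - \<i> * of_real (t * d))"
        by (simp only: norm_scaleR norm_mult norm_cis mult_1)
      also have "\<dots> \<le> \<bar>d\<bar> * ((t * d)\<^sup>2 / 2)"
        by (intro mult_left_mono cmod_cis_approx) simp
      also have "\<dots> = t\<^sup>2 / 2 * \<bar>d\<bar> ^ 3"
        by (simp add: power_mult_distrib power3_eq_cube power2_eq_square)
      also have "\<dots> \<le> t\<^sup>2 / 2 * (4 * q) ^ 3"
        by (intro mult_left_mono power_mono d) auto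
      finally show "cmod (D k l \<sigma> *\<^sub>R (cis (t * W \<sigma>) - cis (t * (W \<sigma> - D k l \<sigma>)))
          - D k l \<sigma> *\<^sub>R (\<i> * of_real (t * D k l \<sigma>) * cis (t * W \<sigma>))) \<le> 32 * t\<^sup>2 * q ^ 3"
        by (simp add: d_def power_mult_distrib mult_ac)
    qed
    finally show ?thesis .
  qed
  have stein: "(\<integral>\<sigma>. W \<sigma> *\<^sub>R cis (t * W \<sigma>) \<partial>P) = (1 / (4 * n)) *\<^sub>R (\<Sum>k\<in>S. \<Sum>l\<in>S. I k l)"
    unfolding I_def by (rule exchange)
  have J_alt: "J k l = \<i> * of_real t * (\<integral>\<sigma>. (D k l \<sigma>)\<^sup>2 *\<^sub>R cis (t * W \<sigma>) \<partial>P)" for k l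
    unfolding J_def integral_mult_right_zero[symmetric]
    by (rule arg_cong[of _ _ "integral\<^sup>L P"])
       (simp add: fun_eq_iff scaleR_conv_of_real power2_eq_square mult_ac)
  have "(\<Sum>k\<in>S. \<Sum>l\<in>S. \<integral>\<sigma>. (D k l \<sigma>)\<^sup>2 *\<^sub>R cis (t * W \<sigma>) \<partial>P) =
      (\<integral>\<sigma>. (\<Sum>k\<in>S. \<Sum>l\<in>S. (D k l \<sigma>)\<^sup>2) *\<^sub>R cis (t * W \<sigma>) \<partial>P)"
    by (simp add: scaleR_sum_left Bochner_Integration.integral_sum)
  also have "\<dots> = (4 * n) *\<^sub>R (\<integral>\<sigma>. Q \<sigma> *\<^sub>R cis (t * W \<sigma>) \<partial>P)"
    unfolding integral_scaleR_right[symmetric] Q_def by simp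
  finally have "(\<Sum>k\<in>S. \<Sum>l\<in>S. J k l) = \<i> * of_real t * ((4 * n) *\<^sub>R (\<integral>\<sigma>. Q \<sigma> *\<^sub>R cis (t * W \<sigma>) \<partial>P))"
    unfolding J_alt sum_distrib_left[symmetric] by simp
  then have J_eq: "(1 / (4 * n)) *\<^sub>R (\<Sum>k\<in>S. \<Sum>l\<in>S. J k l) = \<i> * of_real t * (\<integral>\<sigma>. Q \<sigma> *\<^sub>R cis (t * W \<sigma>) \<partial>P)"
    by simp
  have "cmod ((\<Sum>k\<in>S. \<Sum>l\<in>S. I k l) - (\<Sum>k\<in>S. \<Sum>l\<in>S. J k l)) \<le> (\<Sum>k\<in>S. \<Sum>l\<in>S. 32 * t\<^sup>2 * q ^ 3)"
    unfolding sum_subtractf[symmetric] by (intro sum_norm_le IJ)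
  then have "(1 / (4 * n)) * cmod ((\<Sum>k\<in>S. \<Sum>l\<in>S. I k l) - (\<Sum>k\<in>S. \<Sum>l\<in>S. J k l))
      \<le> (1 / (4 * n)) * (n * (n * (32 * t\<^sup>2 * q ^ 3)))"
    by (intro mult_left_mono) auto
  also have "\<dots> = t\<^sup>2 * (8 * n * q ^ 3)"
    using n_ge by simp
  finally have 1: "cmod ((\<integral>\<sigma>. W \<sigma> *\<^sub>R cis (t * W \<sigma>) \<partial>P) - \<i> * of_real t * (\<integral>\<sigma>. Q \<sigma> *\<^sub>R cis (t * W \<sigma>) \<partial>P))
      \<le> t\<^sup>2 * (8 * n * q ^ 3)"
    unfolding stein J_eq[symmetric] scaleR_diff_right[symmetric] norm_scaleR by simp
  have "(\<integral>\<sigma>. Q \<sigma> *\<^sub>R cis (t * W \<sigma>) \<partial>P) - of_real v * (\<integral>\<sigma>. cis (t * W \<sigma>) \<partial>P)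
      = (\<integral>\<sigma>. (Q \<sigma> - v) *\<^sub>R cis (t * W \<sigma>) \<partial>P)"
    by (simp add: scaleR_diff_left) (simp add: scaleR_conv_of_real)
  also have "cmod \<dots> \<le> (\<integral>\<sigma>. cmod ((Q \<sigma> - v) *\<^sub>R cis (t * W \<sigma>)) \<partial>P)"
    by (rule integral_norm_bound)
  also have "\<dots> \<le> sqrt (2 * n) * q\<^sup>2 / 2 + 2 * q\<^sup>2"
    using Q_dev by simp
  finally have 2: "cmod ((\<integral>\<sigma>. Q \<sigma> *\<^sub>R cis (t * W \<sigma>) \<partial>P) - of_real v * (\<integral>\<sigma>. cis (t * W \<sigma>) \<partial>P))
      \<le> sqrt (2 * n) * q\<^sup>2 / 2 + 2 * q\<^sup>2" .
  have split: "cmod (\<i> * w + of_real t * of_real v * \<phi>)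
      \<le> cmod (\<i> * (w - \<i> * of_real t * z)) + cmod (of_real t * (z - of_real v * \<phi>))" for w z \<phi> :: complex
  proof -
    have "\<i> * w + of_real t * of_real v * \<phi> = \<i> * (w - \<i> * of_real t * z) - of_real t * (z - of_real v * \<phi>)"
      by (simp add: algebra_simps)
    then show ?thesis
      by (simp only: norm_triangle_ineq4)
  qed
  have "cmod (\<i> * (\<integral>\<sigma>. W \<sigma> *\<^sub>R cis (t * W \<sigma>) \<partial>P) + of_real t * of_real v * (\<integral>\<sigma>. cis (t * W \<sigma>) \<partial>P))
      \<le> cmod (\<i> * ((\<integral>\<sigma>. W \<sigma> *\<^sub>R cis (t * W \<sigma>) \<partial>P) - \<i> * of_real t * (\<integral>\<sigma>. Q \<sigma> *\<^sub>R cis (t * W \<sigma>) \<partial>P)))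
        + cmod (of_real t * ((\<integral>\<sigma>. Q \<sigma> *\<^sub>R cis (t * W \<sigma>) \<partial>P) - of_real v * (\<integral>\<sigma>. cis (t * W \<sigma>) \<partial>P)))"
    by (rule split)
  also have "\<dots> \<le> t\<^sup>2 * (8 * n * q ^ 3) + \<bar>t\<bar> * (sqrt (2 * n) * q\<^sup>2 / 2 + 2 * q\<^sup>2)"
    unfolding norm_mult norm_ii norm_of_real mult_1 by (intro add_mono mult_left_mono 1 2) auto
  finally show ?thesis
    by (simp add: v_def)
qed

text \<open>The integrating factor exp(v t^2/2) cancels the main term of the differential equation,
  so the derivative of \<open>\<psi>\<close> consists of the error alone. The mean value inequality
  on [0, 1] starts from \<phi>(0) = 1, and dividing by exp(v/2) at the end removes the exponential
  from the bound.\<close>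

theorem char_bound:
  assumes a_le: "\<And>k. k \<in> S \<Longrightarrow> \<bar>a k\<bar> \<le> \<alpha>" and c_le: "\<And>k. k \<in> S \<Longrightarrow> \<bar>c k\<bar> \<le> \<gamma>"
  defines "q \<equiv> \<alpha> * \<gamma>"
  shows "cmod ((\<integral>\<sigma>. cis (W \<sigma>) \<partial>P) - of_real (exp (- (A * C / n) / 2)))
    \<le> 8 * n * q ^ 3 + (sqrt (2 * n) * q\<^sup>2 / 2 + 2 * q\<^sup>2)"
proof -
  define v where "v = A * C / n"
  define \<phi> where "\<phi> t = (\<integral>\<sigma>. cis (t * W \<sigma>) \<partial>P)" for t
  define \<phi>' where "\<phi>' t = \<i> * (\<integral>\<sigma>. W \<sigma> *\<^sub>R cis (t * W \<sigma>) \<partial>P)" for t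
  define \<psi> where "\<psi> t = exp (v * t\<^sup>2 / 2) *\<^sub>R \<phi> t" for t
  define e where "e = 8 * n * q ^ 3 + (sqrt (2 * n) * q\<^sup>2 / 2 + 2 * q\<^sup>2)"
  have v: "v \<ge> 0"
    unfolding v_def by (intro divide_nonneg_nonneg mult_nonneg_nonneg sum_nonneg) auto
  have q: "q \<ge> 0"
    unfolding q_def using bounds_nonneg[OF a_le c_le] by simp
  have \<phi>_deriv: "(\<phi> has_vector_derivative \<phi>' t) (at t)" for t
    unfolding \<phi>_def \<phi>'_def by (rule char_derivative)
  have \<psi>_deriv: "(\<psi> has_vector_derivative exp (v * t\<^sup>2 / 2) *\<^sub>R (\<phi>' t + of_real t * of_real v * \<phi> t)) (at t)" for t
    unfolding \<psi>_def
    by (auto intro!: derivative_eq_intros has_vector_derivative_scaleR \<phi>_deriv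
        simp: scaleR_conv_of_real algebra_simps)
  have "\<exists>x\<in>{0<..<1}. norm (\<psi> 1 - \<psi> 0)
      \<le> norm ((1 - 0) *\<^sub>R (exp (v * x\<^sup>2 / 2) *\<^sub>R (\<phi>' x + of_real x * of_real v * \<phi> x)))"
  proof (rule mvt_general)
    show "continuous_on {0..1} \<psi>"
      by (intro continuous_at_imp_continuous_on ballI) (rule has_vector_derivative_continuous[OF \<psi>_deriv])
  qed (use \<psi>_deriv in \<open>auto simp only: has_vector_derivative_def\<close>)
  then obtain x where x: "0 < x" "x < 1"
    and "norm (\<psi> 1 - \<psi> 0) \<le> exp (v * x\<^sup>2 / 2) * cmod (\<phi>' x + of_real x * of_real v * \<phi> x)"
    by auto
  note this(3)
  also have "exp (v * x\<^sup>2 / 2) * cmod (\<phi>' x + of_real x * of_real v * \<phi> x) \<le> exp (v / 2) * e"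
  proof (rule mult_mono)
    show "exp (v * x\<^sup>2 / 2) \<le> exp (v / 2)"
      using v x by (simp add: mult_left_le power_le_one)
    have "cmod (\<phi>' x + of_real x * of_real v * \<phi> x)
        \<le> x\<^sup>2 * (8 * n * q ^ 3) + \<bar>x\<bar> * (sqrt (2 * n) * q\<^sup>2 / 2 + 2 * q\<^sup>2)"
      unfolding \<phi>_def \<phi>'_def v_def q_def using char_derivative_approx[OF a_le c_le, of x] by simp
    also have "\<dots> \<le> 1 * (8 * n * q ^ 3) + 1 * (sqrt (2 * n) * q\<^sup>2 / 2 + 2 * q\<^sup>2)"
      using x q by (intro add_mono mult_right_mono) (auto simp: power_le_one)
    finally show "cmod (\<phi>' x + of_real x * of_real v * \<phi> x) \<le> e"
      by (simp add: e_def)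
  qed auto
  finally have "norm (\<psi> 1 - \<psi> 0) \<le> exp (v / 2) * e" .
  moreover have "\<psi> 1 - \<psi> 0 = exp (v / 2) *\<^sub>R (\<phi> 1 - of_real (exp (- v / 2)))"
    by (simp add: \<psi>_def \<phi>_def scaleR_conv_of_real exp_minus right_diff_distrib)
  ultimately have "cmod (\<phi> 1 - of_real (exp (- v / 2))) \<le> e"
    by simp
  then show ?thesis
    by (simp add: \<phi>_def e_def v_def)
qed

end

subsection \<open>The centroid\<close>

lemma sum_cis_multiples_eq_0:
  assumes "0 < m" "m < n"
  shows "(\<Sum>k=1..n. cis (real m * (2 * pi * real k / real n))) = 0"
proof -
  define z where "z = cis (2 * pi * real m / real n)"
  have "z \<noteq> 1"
  proof
    assume "z = 1"
    then have "cos (2 * pi * real m / real n) = 1"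
      by (simp add: z_def complex_eq_iff)
    then obtain j :: int where "2 * pi * real m / real n = j * 2 * pi"
      by (auto simp: cos_one_2pi_int)
    then have "real m = j * real n"
      using assms by (simp add: field_simps)
    then have "int m = j * int n"
      by (metis of_int_eq_iff of_int_mult of_int_of_nat_eq)
    then have "int n dvd int m"
      by simp
    then show False
      using assms by (simp add: nat_dvd_not_less)
  qed
  moreover have "z ^ n = 1"
  proof -
    have "real n * (2 * pi * real m / real n) = 2 * pi * real m"
      using assms by simp
    then show ?thesis
      unfolding z_def by (metis Complex.DeMoivre cis_multiple_2pi Ints_of_nat)
  qed
  moreover have "(\<Sum>k=1..n. cis (real m * (2 * pi * real k / real n))) = (\<Sum>k=1..n. z ^ k)"
    by (intro sum.cong refl) (simp add: z_def Complex.DeMoivre mult_ac)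
  moreover have "(\<Sum>k=1..n. z ^ k) = z * (\<Sum>k<n. z ^ k)"
    by (simp add: sum_distrib_left sum.atLeast1_atMost_eq flip: power_Suc)
  ultimately show ?thesis
    by (simp add: geometric_sum)
qed

lemma sum_trig_combination:
  assumes "n \<ge> 2"
  shows "(\<Sum>k=1..n. s * cos (2 * pi * real k / real n) + t * sin (2 * pi * real k / real n)) = 0"
  using sum_cis_multiples_eq_0[of 1 n] assms
  by (simp add: complex_eq_iff sum.distrib flip: sum_distrib_left)

text \<open>Double angles leave a constant plus oscillating terms of frequency 2, which cancel over
  the n-th roots of unity. This requires 2 < n: for n = 2 the doubled angles are all multiples of 2
  pi.\<close>

lemma sum_trig_combination_squared:
  assumes "n \<ge> 3"
  shows "(\<Sum>k=1..n. (s * cos (2 * pi * real k / real n) + t * sin (2 * pi * real k / real n))\<^sup>2)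
    = real n * (s\<^sup>2 + t\<^sup>2) / 2"
proof -
  have "(s * cos x + t * sin x)\<^sup>2 = (s\<^sup>2 + t\<^sup>2) / 2 + (s\<^sup>2 - t\<^sup>2) / 2 * cos (2 * x) + s * t * sin (2 * x)" for x
  proof -
    have "(s * c + t * d)\<^sup>2 = (s\<^sup>2 + t\<^sup>2) / 2 * (c\<^sup>2 + d\<^sup>2) + (s\<^sup>2 - t\<^sup>2) / 2 * (c\<^sup>2 - d\<^sup>2) + s * t * (2 * d * c)"
      for c d :: real
      by (simp add: power2_eq_square field_simps)
    from this[of "cos x" "sin x"] show ?thesis
      unfolding cos_double sin_double by simp
  qed
  then show ?thesis
    using sum_cis_multiples_eq_0[of 2 n] assms
    by (simp add: complex_eq_iff sum.distrib flip: sum_distrib_left sum_divide_distrib)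
qed

lemma sum_centered: "(\<Sum>j=1..n. real j - (real n + 1) / 2) = 0"
proof -
  have "(\<Sum>j=1..n. real j - x) = real n * (real n + 1) / 2 - real n * x" for x
    by (induction n) (auto simp: field_simps)
  from this[of "(real n + 1) / 2"] show ?thesis by simp
qed

lemma sum_centered_squared:
  "(\<Sum>j=1..n. (real j - (real n + 1) / 2)\<^sup>2) = (real n ^ 3 - real n) / 12"
proof -
  have "(\<Sum>j=1..n. (real j - x)\<^sup>2) =
      real n * (real n + 1) * (2 * real n + 1) / 6 - x * real n * (real n + 1) + real n * x\<^sup>2" for x
    by (induction n) (auto simp: field_simps power2_eq_square)
  from this[of "(real n + 1) / 2"] show ?thesis
    by (simp add: field_simps power2_eq_square power3_eq_cube)
qed

lemma unif_perm_eq: "unif_perm n = perm_pmf {1..n}"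
  by (simp add: unif_perm_def perm_pmf_def)

section \<open>The scaled centroid as a centred permutation sum\<close>

definition angle_coeff :: "nat \<Rightarrow> real \<Rightarrow> real \<Rightarrow> nat \<Rightarrow> real" where
  "angle_coeff n s t k = s * cos (2 * pi * real k / real n) + t * sin (2 * pi * real k / real n)"

text \<open>The scores carry the whole normalisation, 1/n from the centroid and 1/sqrt n from the
  scaling, so that the angle coefficients stay bounded uniformly in n.\<close>

definition rank_score :: "nat \<Rightarrow> nat \<Rightarrow> real" where
  "rank_score n j = (real j - (real n + 1) / 2) / (real n * sqrt (real n))"

lemma centered_perm_sum_centroid:
  assumes "n \<ge> 2"
  shows "centered_perm_sum {1..n} (angle_coeff n s t) (rank_score n)"
proof
  show "(\<Sum>k=1..n. angle_coeff n s t k) = 0"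
    unfolding angle_coeff_def by (rule sum_trig_combination) fact
  show "(\<Sum>k=1..n. rank_score n k) = 0"
    unfolding rank_score_def sum_divide_distrib[symmetric] sum_centered by simp
qed (use assms in auto)

lemma abs_angle_coeff_le: "\<bar>angle_coeff n s t k\<bar> \<le> \<bar>s\<bar> + \<bar>t\<bar>"
proof -
  have "\<bar>s * x + t * y\<bar> \<le> \<bar>s\<bar> + \<bar>t\<bar>" if "\<bar>x\<bar> \<le> 1" "\<bar>y\<bar> \<le> 1" for x y
    using mult_left_le[OF that(1), of "\<bar>s\<bar>"] mult_left_le[OF that(2), of "\<bar>t\<bar>"]
    by (intro order.trans[OF abs_triangle_ineq]) (auto simp: abs_mult)
  then show ?thesis
    by (simp add: angle_coeff_def)
qed

lemma abs_rank_score_le: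
  assumes "k \<in> {1..n}"
  shows "\<bar>rank_score n k\<bar> \<le> 1 / sqrt (real n)"
proof -
  have "real k \<ge> 1" "real k \<le> real n"
    using assms by auto
  then have "\<bar>real k - (real n + 1) / 2\<bar> \<le> real n"
    by (simp add: abs_le_iff field_simps)
  then have "\<bar>real k - (real n + 1) / 2\<bar> / (real n * sqrt (real n)) \<le> real n / (real n * sqrt (real n))"
    by (rule divide_right_mono) simp
  then have "\<bar>rank_score n k\<bar> \<le> real n / (real n * sqrt (real n))"
    unfolding rank_score_def abs_divide abs_mult by simp
  then show ?thesis
    using assms by simp
qed

text \<open>Centring the ranks changes nothing, because the subtracted constant multiplies a
  vanishing sum of angle coefficients.\<close>

lemma perm_sum_centroid:
  assumes n: "n \<ge> 2"
  shows "perm_sum {1..n} (angle_coeff n s t) (rank_score n) \<sigma> =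
    s * (Re (centroid n \<sigma>) / sqrt (real n)) + t * (Im (centroid n \<sigma>) / sqrt (real n))"
proof -
  have "perm_sum {1..n} (angle_coeff n s t) (rank_score n) \<sigma> =
      (\<Sum>k=1..n. angle_coeff n s t k * real (\<sigma> k) - angle_coeff n s t k * ((real n + 1) / 2))
        / (real n * sqrt (real n))"
    unfolding perm_sum_def rank_score_def sum_divide_distrib
    by (simp add: right_diff_distrib diff_divide_distrib)
  also have "\<dots> = (\<Sum>k=1..n. angle_coeff n s t k * real (\<sigma> k)) / (real n * sqrt (real n))"
    unfolding sum_subtractf sum_distrib_right[symmetric]
    using sum_trig_combination[OF n] by (simp add: angle_coeff_def)
  also have "\<dots> = s * (Re (centroid n \<sigma>) / sqrt (real n)) + t * (Im (centroid n \<sigma>) / sqrt (real n))"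
  proof -
    have "Re (centroid n \<sigma>) = (\<Sum>k=1..n. real (\<sigma> k) * cos (2 * pi * real k / real n)) / real n"
      "Im (centroid n \<sigma>) = (\<Sum>k=1..n. real (\<sigma> k) * sin (2 * pi * real k / real n)) / real n"
      unfolding centroid_def by (simp_all add: Re_divide_of_nat Im_divide_of_nat)
    moreover have "(\<Sum>k=1..n. angle_coeff n s t k * real (\<sigma> k)) =
        s * (\<Sum>k=1..n. real (\<sigma> k) * cos (2 * pi * real k / real n))
        + t * (\<Sum>k=1..n. real (\<sigma> k) * sin (2 * pi * real k / real n))"
      unfolding angle_coeff_def sum_distrib_left sum.distrib[symmetric]
      by (intro sum.cong refl) (simp add: algebra_simps)
    ultimately show ?thesis
      by (simp only: add_divide_distrib times_divide_eq_right divide_divide_eq_left)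
  qed
  finally show ?thesis .
qed

lemma sum_rank_score_squared:
  assumes "n > 0"
  shows "(\<Sum>j=1..n. (rank_score n j)\<^sup>2) = (1 - 1 / (real n)\<^sup>2) / 12"
proof -
  have "(\<Sum>j=1..n. (rank_score n j)\<^sup>2) = (\<Sum>j=1..n. (real j - (real n + 1) / 2)\<^sup>2) / (real n ^ 3)"
  proof -
    have "(real n * sqrt (real n))\<^sup>2 = real n ^ 3"
      by (simp add: power_mult_distrib power2_eq_square[of "real n"] power3_eq_cube)
    then show ?thesis
      by (simp only: rank_score_def power_divide sum_divide_distrib)
  qed
  also have "\<dots> = (1 - 1 / (real n)\<^sup>2) / 12"
    using assms unfolding sum_centered_squared by (simp add: field_simps power2_eq_square power3_eq_cube)
  finally show ?thesis .
qed

lemma char_centroid_tendsto: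
  "(\<lambda>n. \<integral>\<sigma>. cis (s * (Re (centroid n \<sigma>) / sqrt (real n)) + t * (Im (centroid n \<sigma>) / sqrt (real n)))
      \<partial>unif_perm n) \<longlonglongrightarrow> of_real (exp (- ((s\<^sup>2 + t\<^sup>2) / 48)))"
proof -
  \<comment> \<open>The summand 1 keeps \<open>K\<close> positive even for s = t = 0, which the
    asymptotic analysis of \<open>e\<close> uses.\<close>
  define K where "K = \<bar>s\<bar> + \<bar>t\<bar> + 1"
  \<comment> \<open>This is the product of n (s^2 + t^2)/2 and (1 - 1/n^2)/12, divided by n.\<close>
  define v where "v n = (s\<^sup>2 + t\<^sup>2) / 24 * (1 - 1 / (real n)\<^sup>2)" for n
  define \<phi> where "\<phi> n = (\<integral>\<sigma>. cis (s * (Re (centroid n \<sigma>) / sqrt (real n)) + t * (Im (centroid n \<sigma>) / sqrt (real n)))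
      \<partial>unif_perm n)" for n
  define e where "e n = 8 * real n * (K * (1 / sqrt (real n))) ^ 3
      + (sqrt (2 * real n) * (K * (1 / sqrt (real n)))\<^sup>2 / 2 + 2 * (K * (1 / sqrt (real n)))\<^sup>2)" for n
  have bound: "cmod (\<phi> n - of_real (exp (- v n / 2))) \<le> e n" if n: "n \<ge> 3" for n
  proof -
    interpret centered_perm_sum "{1..n}" "angle_coeff n s t" "rank_score n"
      by (rule centered_perm_sum_centroid) (use n in simp)
    have "\<bar>angle_coeff n s t k\<bar> \<le> K" for k
      using abs_angle_coeff_le[of n s t k] by (simp add: K_def)
    note bound = char_bound[OF this abs_rank_score_le]
    have v_eq: "(\<Sum>k=1..n. (angle_coeff n s t k)\<^sup>2) * (\<Sum>k=1..n. (rank_score n k)\<^sup>2) / real (card {1..n}) = v n"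
    proof -
      have "(\<Sum>k=1..n. (angle_coeff n s t k)\<^sup>2) = real n * (s\<^sup>2 + t\<^sup>2) / 2"
        unfolding angle_coeff_def by (rule sum_trig_combination_squared[OF n])
      moreover have "(\<Sum>k=1..n. (rank_score n k)\<^sup>2) = (1 - 1 / (real n)\<^sup>2) / 12"
        using n by (intro sum_rank_score_squared) simp
      ultimately show ?thesis
        using n by (simp only: v_def) simp
    qed
    have \<phi>_eq: "\<phi> n = (\<integral>\<sigma>. cis (perm_sum {1..n} (angle_coeff n s t) (rank_score n) \<sigma>) \<partial>perm_pmf {1..n})"
      unfolding \<phi>_def unif_perm_eq using n by (subst perm_sum_centroid) simp_all
    show ?thesis
      using bound unfolding v_eq \<phi>_eq[symmetric] by (simp add: e_def)
  qed
  have "e \<longlonglongrightarrow> 0"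
  proof -
    have "K > 0"
      by (simp add: K_def add_nonneg_pos)
    then show ?thesis
      unfolding e_def by real_asymp
  qed
  then have "(\<lambda>n. \<phi> n - of_real (exp (- v n / 2))) \<longlonglongrightarrow> 0"
    by (rule Lim_null_comparison[rotated]) (use bound in \<open>auto simp: eventually_sequentially\<close>)
  moreover have "(\<lambda>n. of_real (exp (- v n / 2)) :: complex) \<longlonglongrightarrow> of_real (exp (- ((s\<^sup>2 + t\<^sup>2) / 48)))"
  proof -
    have "(\<lambda>n. 1 - 1 / (real n)\<^sup>2) \<longlonglongrightarrow> 1"
      by real_asymp
    then have "v \<longlonglongrightarrow> (s\<^sup>2 + t\<^sup>2) / 24 * 1"
      unfolding v_def by (intro tendsto_intros)
    then have "(\<lambda>n. of_real (exp (- v n / 2)) :: complex) \<longlonglongrightarrow> of_real (exp (- ((s\<^sup>2 + t\<^sup>2) / 24 * 1) / 2))"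
      by (intro tendsto_intros) auto
    then show ?thesis by simp
  qed
  ultimately have "(\<lambda>n. (\<phi> n - of_real (exp (- v n / 2))) + of_real (exp (- v n / 2)))
      \<longlonglongrightarrow> 0 + of_real (exp (- ((s\<^sup>2 + t\<^sup>2) / 48)))"
    by (rule tendsto_add)
  then show ?thesis
    by (simp add: \<phi>_def)
qed

text \<open>This is the tightness bound. Each coordinate is the linear form for (s, t) = (1, 0) or
  (0, 1), with coefficients bounded by 1 and scores by 1/sqrt n, so each second moment is at most
  2.\<close>

lemma centroid_second_moment_le:
  assumes n: "n \<ge> 2"
  shows "(\<integral>\<sigma>. (norm (Re (centroid n \<sigma>) / sqrt (real n), Im (centroid n \<sigma>) / sqrt (real n)))\<^sup>2 \<partial>unif_perm n) \<le> 4"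
proof -
  have le: "(\<integral>\<sigma>. (s * (Re (centroid n \<sigma>) / sqrt (real n)) + t * (Im (centroid n \<sigma>) / sqrt (real n)))\<^sup>2
      \<partial>unif_perm n) \<le> 2" if "\<bar>s\<bar> + \<bar>t\<bar> = 1" for s t
  proof -
    interpret centered_perm_sum "{1..n}" "angle_coeff n s t" "rank_score n"
      by (rule centered_perm_sum_centroid) fact
    have "\<bar>angle_coeff n s t k\<bar> \<le> 1" for k
      using abs_angle_coeff_le[of n s t k] that by simp
    note second_moment_le[OF this abs_rank_score_le]
    then show ?thesis
      unfolding unif_perm_eq perm_sum_centroid[OF n, symmetric] using n by (simp add: power_divide)
  qed
  have int: "integrable (unif_perm n) f" for f :: "_ \<Rightarrow> real"
    unfolding unif_perm_eq by simp
  show ?thesis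
    using le[of 1 0] le[of 0 1] by (simp add: norm_Pair int power_divide)
qed

subsection \<open>Gaussian measures\<close>

lemma char_normal:
  assumes "\<sigma> > 0"
  shows "(\<integral>x. cis (s * x) \<partial>density lborel (normal_density 0 \<sigma>)) = of_real (exp (- (s * \<sigma>)\<^sup>2 / 2))"
proof -
  interpret std: prob_space std_normal_distribution
    by (rule prob_space_normal_density) simp
  have "distr std_normal_distribution lborel (\<lambda>x. x) = std_normal_distribution"
    by (rule distr_id2) simp
  then have "distributed std_normal_distribution lborel (\<lambda>x. x) std_normal_density"
    by (simp add: distributed_def)
  from std.normal_density_affine[OF this, of \<sigma> 0] assms
  have "distr std_normal_distribution lborel (\<lambda>x. \<sigma> * x) = density lborel (normal_density 0 \<sigma>)"
    by (simp add: distributed_def)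
  then have "(\<integral>x. cis (s * x) \<partial>density lborel (normal_density 0 \<sigma>)) =
      (\<integral>x. cis (s * x) \<partial>distr std_normal_distribution lborel (\<lambda>x. \<sigma> * x))"
    by simp
  also have "\<dots> = (\<integral>x. cis (s * (\<sigma> * x)) \<partial>std_normal_distribution)"
  proof (rule integral_distr)
    have "continuous_on UNIV (\<lambda>x. cis (s * x))"
      by (intro continuous_intros)
    then show "(\<lambda>x. cis (s * x)) \<in> borel_measurable lborel"
      by (simp add: borel_measurable_continuous_onI)
  qed simp
  also have "\<dots> = char std_normal_distribution (s * \<sigma>)"
    by (simp add: char_def cis_conv_exp mult_ac)
  finally show ?thesis
    by (simp add: char_std_normal_distribution)
qed

lemma gauss2_isotropic_density:
  assumes "v > 0"
  shows "gauss2_density 0 0 v 0 v (x, y) = exp (- (x\<^sup>2 + y\<^sup>2) / (2 * v)) / (2 * pi * v)"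
proof -
  have "- (v * x\<^sup>2 + v * y\<^sup>2) / (2 * (v * v)) = - (x\<^sup>2 + y\<^sup>2) / (2 * v)"
    using assms by (simp add: divide_simps) (simp add: algebra_simps)
  then show ?thesis
    using assms by (simp add: gauss2_density_def Let_def real_sqrt_mult)
qed

text \<open>Without correlation the density factors, so the coordinates are independent and the
  characteristic function reduces to the one-dimensional one.\<close>

lemma gauss2_isotropic:
  assumes "v > 0"
  defines "N \<equiv> density lborel (normal_density 0 (sqrt v))"
  shows "gauss2 0 0 v 0 v = N \<Otimes>\<^sub>M N"
proof -
  interpret N: prob_space N
    unfolding N_def by (rule prob_space_normal_density) (simp add: assms)
  have "N \<Otimes>\<^sub>M N = density (lborel \<Otimes>\<^sub>M lborel)
      (\<lambda>(x, y). ennreal (normal_density 0 (sqrt v) x) * ennreal (normal_density 0 (sqrt v) y))"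
    unfolding N_def
    by (rule pair_measure_density)
       (use N.sigma_finite_measure_axioms in \<open>simp_all add: N_def lborel.sigma_finite_measure_axioms\<close>)
  also have "\<dots> = density lborel (\<lambda>p. ennreal (gauss2_density 0 0 v 0 v p))"
  proof -
    have "normal_density 0 (sqrt v) x * normal_density 0 (sqrt v) y = gauss2_density 0 0 v 0 v (x, y)" for x y
    proof -
      have 1: "normal_density 0 (sqrt v) z = exp (- z\<^sup>2 / (2 * v)) / sqrt (2 * pi * v)" for z
        using assms(1) by (simp add: normal_density_def)
      have 2: "exp (- x\<^sup>2 / (2 * v)) * exp (- y\<^sup>2 / (2 * v)) = exp (- (x\<^sup>2 + y\<^sup>2) / (2 * v))"
        by (simp add: mult_exp_exp diff_divide_distrib)
      have 3: "sqrt (2 * pi * v) * sqrt (2 * pi * v) = 2 * pi * v"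
        using assms(1) by (intro real_sqrt_mult_self[THEN trans]) simp
      show ?thesis
        unfolding gauss2_isotropic_density[OF assms(1)] 1 times_divide_times_eq 2 3 ..
    qed
    then show ?thesis
      unfolding lborel_prod
      by (intro arg_cong[of _ _ "density lborel"] ext)
         (auto simp: normal_density_nonneg simp flip: ennreal_mult)
  qed
  finally show ?thesis
    by (simp add: gauss2_def)
qed

lemma prob_space_gauss2_isotropic:
  assumes "v > 0"
  shows "prob_space (gauss2 0 0 v 0 v)"
proof -
  interpret N: prob_space "density lborel (normal_density 0 (sqrt v))"
    by (rule prob_space_normal_density) (simp add: assms)
  interpret pair_prob_space "density lborel (normal_density 0 (sqrt v))" "density lborel (normal_density 0 (sqrt v))" ..
  show ?thesis
    unfolding gauss2_isotropic[OF assms] by (rule P.prob_space_axioms)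
qed

lemma sets_gauss2: "sets (gauss2 m1 m2 a b c) = sets borel"
  by (simp add: gauss2_def)

lemma char_gauss2_isotropic:
  assumes v: "v > 0"
  shows "(\<integral>p. cis (s * fst p + t * snd p) \<partial>gauss2 0 0 v 0 v) = of_real (exp (- v * (s\<^sup>2 + t\<^sup>2) / 2))"
proof -
  define N where "N = density lborel (normal_density 0 (sqrt v))"
  interpret N: prob_space N
    unfolding N_def by (rule prob_space_normal_density) (simp add: assms)
  interpret pair_prob_space N N ..
  have G: "gauss2 0 0 v 0 v = N \<Otimes>\<^sub>M N"
    unfolding N_def by (rule gauss2_isotropic) fact
  have "integrable (N \<Otimes>\<^sub>M N) (\<lambda>p. cis (s * fst p + t * snd p))"
    unfolding G[symmetric]
  proof (rule finite_measure.integrable_const_bound[where B = 1])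
    show "finite_measure (gauss2 0 0 v 0 v)"
      using prob_space_gauss2_isotropic[OF v] by (rule prob_space.finite_measure)
    have "continuous_on UNIV (\<lambda>p::real \<times> real. cis (s * fst p + t * snd p))"
      by (intro continuous_intros)
    then show "(\<lambda>p. cis (s * fst p + t * snd p)) \<in> borel_measurable (gauss2 0 0 v 0 v)"
      by (simp add: measurable_cong_sets[OF sets_gauss2 refl] borel_measurable_continuous_onI)
  qed simp
  then have "(\<integral>p. cis (s * fst p + t * snd p) \<partial>(N \<Otimes>\<^sub>M N)) = (\<integral>x. \<integral>y. cis (s * x + t * y) \<partial>N \<partial>N)"
    by (subst integral_fst'[symmetric]) simp_all
  also have "\<dots> = (\<integral>x. cis (s * x) \<partial>N) * (\<integral>y. cis (t * y) \<partial>N)"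
    by (simp flip: cis_mult)
  also have "\<dots> = of_real (exp (- v * (s\<^sup>2 + t\<^sup>2) / 2))"
    using v by (simp add: N_def char_normal power_mult_distrib flip: of_real_mult exp_add)
      (simp add: algebra_simps)
  finally show ?thesis
    by (simp add: G)
qed

section \<open>Transfer to the complex plane\<close>

lemma lborel_complex: "(lborel :: complex measure) = distr lborel borel (\<lambda>(x, y). Complex x y)"
proof (rule lborel_eqI)
  fix l u :: complex assume le: "\<And>b. b \<in> Basis \<Longrightarrow> l \<bullet> b \<le> u \<bullet> b"
  have cont: "continuous_on UNIV (\<lambda>(x, y). Complex x y)"
    unfolding Complex_eq case_prod_beta by (intro continuous_intros)
  \<comment> \<open>Lebesgue measure is determined by its values on boxes, and a complex box pulls
    back to a product of intervals.\<close>
  have "(\<lambda>(x, y). Complex x y) -` box l u = box (Re l) (Re u) \<times> box (Im l) (Im u)"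
    by (auto simp: box_def Basis_complex_def inner_complex_def)
  then have "emeasure (distr lborel borel (\<lambda>(x, y). Complex x y)) (box l u) =
      emeasure (lborel \<Otimes>\<^sub>M lborel) (box (Re l) (Re u) \<times> box (Im l) (Im u))"
    using borel_measurable_continuous_onI[OF cont] by (simp add: emeasure_distr lborel_prod)
  also have "\<dots> = (Re u - Re l) * (Im u - Im l)"
    using le[of 1] le[of \<i>]
    by (subst lborel.emeasure_pair_measure_Times) (auto simp: inner_complex_def ennreal_mult)
  also have "\<dots> = (\<Prod>b\<in>Basis. (u - l) \<bullet> b)"
    by (simp add: Basis_complex_def inner_complex_def)
  finally show "emeasure (distr lborel borel (\<lambda>(x, y). Complex x y)) (box l u) = (\<Prod>b\<in>Basis. (u - l) \<bullet> b)" .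
qed simp

text \<open>The parameter doubles because the complex variance is the sum of the variances of the
  real and imaginary parts; thus 1/24 becomes 1/12.\<close>

lemma complex_normal_eq_distr_gauss2:
  assumes "v > 0"
  shows "complex_normal (2 * v) = distr (gauss2 0 0 v 0 v) borel (\<lambda>(x, y). Complex x y)"
proof -
  have "continuous_on UNIV (\<lambda>(x, y). Complex x y)"
    unfolding Complex_eq case_prod_beta by (intro continuous_intros)
  then have meas: "(\<lambda>(x, y). Complex x y) \<in> lborel \<rightarrow>\<^sub>M borel"
    by (simp add: borel_measurable_continuous_onI)
  have "complex_normal (2 * v) = density (distr lborel borel (\<lambda>(x, y). Complex x y))
      (\<lambda>z. ennreal (exp (- (cmod z)\<^sup>2 / (2 * v)) / (pi * (2 * v))))"
    unfolding complex_normal_def by (subst lborel_complex) simp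
  also have "\<dots> = distr (density lborel
      (\<lambda>p. ennreal (exp (- (cmod (case p of (x, y) \<Rightarrow> Complex x y))\<^sup>2 / (2 * v)) / (pi * (2 * v))))) borel
      (\<lambda>(x, y). Complex x y)"
    by (rule density_distr[OF _ meas]) measurable
  also have "(\<lambda>p. ennreal (exp (- (cmod (case p of (x, y) \<Rightarrow> Complex x y))\<^sup>2 / (2 * v)) / (pi * (2 * v)))) =
      (\<lambda>p. ennreal (gauss2_density 0 0 v 0 v p))"
    by (rule ext) (auto simp: gauss2_isotropic_density[OF assms] cmod_power2 mult_ac)
  finally show ?thesis
    by (simp add: gauss2_def)
qed

theorem theorem1:
  shows "weak_conv
           (\<lambda>n. measure_pmf (map_pmf
              (\<lambda>\<sigma>. (Re (centroid n \<sigma>) / sqrt (real n), Im (centroid n \<sigma>) / sqrt (real n)))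
              (unif_perm n)))
           (gauss2 0 0 (1/24) 0 (1/24))
       \<and> weak_conv
           (\<lambda>n. measure_pmf (map_pmf (\<lambda>\<sigma>. centroid n \<sigma> / of_real (sqrt (real n))) (unif_perm n)))
           (complex_normal (1/12))"
proof
  let ?XY = "\<lambda>n \<sigma>. (Re (centroid n \<sigma>) / sqrt (real n), Im (centroid n \<sigma>) / sqrt (real n))"
  show conv: "weak_conv (\<lambda>n. measure_pmf (map_pmf (?XY n) (unif_perm n))) (gauss2 0 0 (1/24) 0 (1/24))"
  proof (rule char_tendsto_imp_weak_conv)
    fix n
    show "prob_space (map_pmf (?XY n) (unif_perm n))"
      by (rule prob_space_measure_pmf)
    show "integrable (map_pmf (?XY n) (unif_perm n)) (\<lambda>p. (norm p)\<^sup>2)"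
      by (rule integrable_measure_pmf_finite)
         (simp add: unif_perm_eq set_perm_pmf finite_permutations)
  next
    \<comment> \<open>The bound starts at n = 2, since for n = 1 the single root of unity is 1 and
      the angle coefficients are not centred.\<close>
    show "\<forall>\<^sub>F n in sequentially. (\<integral>p. (norm p)\<^sup>2 \<partial>map_pmf (?XY n) (unif_perm n)) \<le> 4"
      using eventually_ge_at_top[of 2]
      by eventually_elim (use centroid_second_moment_le in simp)
  next
    fix s t :: real
    show "(\<lambda>n. \<integral>p. cis (s * fst p + t * snd p) \<partial>map_pmf (?XY n) (unif_perm n))
        \<longlonglongrightarrow> (\<integral>p. cis (s * fst p + t * snd p) \<partial>gauss2 0 0 (1/24) 0 (1/24))"
      using char_centroid_tendsto[of s t] by (simp add: char_gauss2_isotropic)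
  qed (simp_all add: prob_space_gauss2_isotropic sets_gauss2)
  show "weak_conv (\<lambda>n. measure_pmf (map_pmf (\<lambda>\<sigma>. centroid n \<sigma> / of_real (sqrt (real n))) (unif_perm n)))
      (complex_normal (1/12))"
    unfolding weak_conv_def
  proof (intro allI impI, elim conjE)
    fix f :: "complex \<Rightarrow> real"
    assume f: "bounded (range f)" "continuous_on UNIV f"
    \<comment> \<open>A bounded continuous test function on the complex plane pulls back to one on
      the real plane, so the convergence already shown applies to it.\<close>
    define g where "g = (\<lambda>(x, y). f (Complex x y))"
    have cont: "continuous_on UNIV (\<lambda>(x, y). Complex x y)"
      unfolding Complex_eq case_prod_beta by (intro continuous_intros)
    have "bounded (range g)"
      by (rule bounded_subset[OF f(1)]) (auto simp: g_def)
    moreover have "continuous_on UNIV g"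
      using continuous_on_compose2[OF f(2) cont] by (simp add: g_def case_prod_beta)
    ultimately have "(\<lambda>n. \<integral>p. g p \<partial>map_pmf (?XY n) (unif_perm n)) \<longlonglongrightarrow> (\<integral>p. g p \<partial>gauss2 0 0 (1/24) 0 (1/24))"
      using conv unfolding weak_conv_def by blast
    moreover have "(\<integral>z. f z \<partial>complex_normal (1/12)) = (\<integral>p. g p \<partial>gauss2 0 0 (1/24) 0 (1/24))"
    proof -
      have "(\<lambda>(x, y). Complex x y) \<in> gauss2 0 0 (1/24) 0 (1/24) \<rightarrow>\<^sub>M borel"
        by (simp add: measurable_cong_sets[OF sets_gauss2 refl] borel_measurable_continuous_onI[OF cont])
      then show ?thesis
        using complex_normal_eq_distr_gauss2[of "1/24"] borel_measurable_continuous_onI[OF f(2)]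
        by (simp add: integral_distr g_def case_prod_beta)
    qed
    moreover have "Complex (Re z / x) (Im z / x) = z / of_real x" for z x
      by (simp add: complex_eq_iff Re_divide_of_real Im_divide_of_real)
    ultimately show "(\<lambda>n. \<integral>z. f z \<partial>map_pmf (\<lambda>\<sigma>. centroid n \<sigma> / of_real (sqrt (real n))) (unif_perm n))
        \<longlonglongrightarrow> (\<integral>z. f z \<partial>complex_normal (1/12))"
      by (simp add: g_def)
  qed
qed

end
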